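(* Let $\mathfrak{g}$ be a finite-dimensional simple Lie algebra over $\mathbb{C}$ with index set $I$, let $m>1$ be an integer, and let $i\in I$. Write $\mathcal{Y}_m^{r_i}$ for the subfield of $r_i$-invariant elements of $\mathcal{Y}_m$. (a) If $\alpha_i$ is a shortest root (i.e. $d_i=d$), then $\mathcal{Y}_m^{r_i}=\mathcal{Z}_m^{(i)}$. (b) If $\alpha_i$ is not a shortest root, then $\mathcal{Y}_m^{r_i}=\mathcal{Z}_m^{(i)\prime}$, where $\mathcal{Z}_m^{(i)\prime}=\mathcal{Z}_m^{(i)}(\delta_{i,1}\delta_{i,2})$ if $d_i=2d$ and $\mathcal{Z}_m^{(i)\prime}=\mathcal{Z}_m^{(i)}(\delta_{i,1}\delta_{i,2},\,\delta_{i,2}\delta_{i,3})$ if $d_i=3d$. Moreover the degree $[\mathcal{Z}_m^{(i)\prime}:\mathcal{Z}_m^{(i)}]$ is two if $d_i=2d$ and four if $d_i=3d$.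
   Context: Lie data. $\mathfrak{g}$ has rank $\ell$, $I=\{1,\dots,\ell\}$, simple roots $\alpha_i$, Cartan matrix $C_{ij}=2(\alpha_i,\alpha_j)/(\alpha_i,\alpha_i)$. Put $d_i=\frac12(\alpha_i,\alpha_i)$, $d=\min_i d_i$, $d'=\max_i d_i$, normalized as follows: types $A_\ell,D_\ell,E_\ell$: all $d_i=1$, $d=d'=1$; $B_\ell$: $d_i=1$ for $i\le \ell-1$, $d_\ell=\frac12$, $d=\frac12,d'=1$; $C_\ell$: $d_i=1$ for $i\le\ell-1$, $d_\ell=2$, $d=1,d'=2$; $F_4$: $d_1=d_2=1$, $d_3=d_4=\frac12$, $d=\frac12,d'=1$; $G_2$: $d_1=1,d_2=3$, $d=1,d'=3$. Labelling of Dynkin diagrams: in types $A_\ell,B_\ell,C_\ell,F_4,G_2$ the vertices $1,2,\dots,\ell$ form a chain in this order; in type $D_\ell$ ($\ell\ge4$) the vertices $1,\dots,\ell-1$ form a chain and $\ell$ is attached to $\ell-2$; in type $E_\ell$ ($\ell=6,7,8$) the vertices $1,2,3,5,6,\dots,\ell$ form a chain and $4$ is attached to $3$. For $j\ne i$, $C_{ij}\neq0$ iff $i,j$ are adjacent. Fields and elements. $\mathcal{Y}_m=\mathbb{C}(y_i(n);\, i\in I,\ n\in d\mathbb{Z}/d'm\mathbb{Z})$ is the rational function field in independent commuting variables $y_i(n)$. For $(i,n)\in I\times d\mathbb{Z}/d'm\mathbb{Z}$ let (with the convention $y_0(n)=y_{\ell+1}(n)=1$) $$F_i(n)=\begin{cases}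 y_{i-1}(n+\tfrac12)\,y_{i+1}(n) & (\mathfrak g,i)=(B_\ell,\ell),(F_4,3);\\ y_{i-1}(n+1)\,y_{i+1}(n)\,y_{i+1}(n+\tfrac12) & (\mathfrak g,i)=(B_\ell,\ell-1),(F_4,2);\\ y_{\ell-1}(n+1)\,y_{\ell-1}(n+2) & (\mathfrak g,i)=(C_\ell,\ell);\\ y_1(n+1)y_1(n+2)y_1(n+3) & (\mathfrak g,i)=(G_2,2);\\ \prod_{j<i,\,C_{ij}\ne0} y_j(n+d_j)\prod_{j>i,\,C_{ij}\neq0}y_j(n) & \text{otherwise,}\end{cases}$$ $$X_i(n)=\frac{F_i(n)}{y_i(n)y_i(n+d_i)},\qquad P_i(n)=1+\sum_{k=0}^{\frac{d'm}{d_i}-2}X_i(n)X_i(n-d_i)\cdots X_i(n-d_ik).$$ Action. The Weyl group $W$ of $\mathfrak g$, generated by the simple reflections $r_i$, acts on $\mathcal{Y}_m$ by $\mathbb{C}$-algebra automorphisms determined by (known to be a well-defined $W$-action) $$r_i(y_i(n))=\frac{P_i(n-2d_i)}{P_i(n-d_i)}\,y_i(n)X_i(n-d_i),\qquad r_i(y_j(n))=y_j(n)\ (j\ne i).$$ Subfields. $z_i(n)=y_i(n)+\dfrac{F_i(n)}{y_i(n+d_i)}$ and $\mathcal{Z}_m^{(i)}=\mathbb{C}(z_i(n),y_j(n);\ j\in I\setminus\{i\},\ n\in d\mathbb{Z}/d'm\mathbb{Z})\subset\mathcal{Y}_m$. For an integer $1\le s\le d_i/d$ put $N_{i,s}=(d_i\mathbb{Z}+(s-1)d)/d'm\mathbb{Z}\subset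 d\mathbb{Z}/d'm\mathbb{Z}$, $\boldsymbol{y}_{i,s}=\prod_{n\in N_{i,s}}y_i(n)$, $\boldsymbol{F}_{i,s}=\prod_{n\in N_{i,s}}F_i(n)$, $\delta_{i,s}=\boldsymbol{y}_{i,s}-\boldsymbol{F}_{i,s}/\boldsymbol{y}_{i,s}$. *)

theory Defs
  imports
    "HOL-Library.Poly_Mapping"
    "HOL-Computational_Algebra.Fraction_Field"
    "HOL-Algebra.Generated_Fields"
    "HOL-Algebra.Embedded_Algebras"
    "HOL-Algebra.Algebraic_Closure_Type"
begin

section \<open>Lie data\<close>

text \<open>
  A finite-dimensional simple complex Lie algebra is represented by its Cartan-Killing type.
  All quantities below depend on the algebra only through this type. The types \<open>Type_B 2\<close> and \<open>Type_C 2\<close>,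
  which belong to the same algebra, are both admitted: they differ by the labelling of the
  Dynkin diagram and by the normalization of the form.
\<close>

datatype lie_type =
  Type_A nat | Type_B nat | Type_C nat | Type_D nat | Type_E nat | Type_F4 | Type_G2

fun simple_lie_type :: "lie_type \<Rightarrow> bool" where
  "simple_lie_type (Type_A l) \<longleftrightarrow> l \<ge> 1"
| "simple_lie_type (Type_B l) \<longleftrightarrow> l \<ge> 2"
| "simple_lie_type (Type_C l) \<longleftrightarrow> l \<ge> 2"
| "simple_lie_type (Type_D l) \<longleftrightarrow> l \<ge> 4"
| "simple_lie_type (Type_E l) \<longleftrightarrow> l \<in> {6, 7, 8}"
| "simple_lie_type Type_F4 \<longleftrightarrow> True"
| "simple_lie_type Type_G2 \<longleftrightarrow> True"

fun rank :: "lie_type \<Rightarrow> nat" where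
  "rank (Type_A l) = l"
| "rank (Type_B l) = l"
| "rank (Type_C l) = l"
| "rank (Type_D l) = l"
| "rank (Type_E l) = l"
| "rank Type_F4 = 4"
| "rank Type_G2 = 2"

definition index_set :: "lie_type \<Rightarrow> nat set" where
  "index_set g = {1..rank g}"

fun half_norm :: "lie_type \<Rightarrow> nat \<Rightarrow> rat" \<comment> \<open>\<open>d\<^sub>i = (\<alpha>\<^sub>i, \<alpha>\<^sub>i) / 2\<close>\<close> where
  "half_norm (Type_A l) i = 1"
| "half_norm (Type_B l) i = (if i = l then 1/2 else 1)"
| "half_norm (Type_C l) i = (if i = l then 2 else 1)"
| "half_norm (Type_D l) i = 1"
| "half_norm (Type_E l) i = 1"
| "half_norm Type_F4 i = (if i \<le> 2 then 1 else 1/2)"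
| "half_norm Type_G2 i = (if i = 1 then 1 else 3)"

definition min_half_norm :: "lie_type \<Rightarrow> rat" \<comment> \<open>\<open>d\<close>\<close> where
  "min_half_norm g = Min (half_norm g ` index_set g)"

definition max_half_norm :: "lie_type \<Rightarrow> rat" \<comment> \<open>\<open>d'\<close>\<close> where
  "max_half_norm g = Max (half_norm g ` index_set g)"

text \<open>The edges \<open>{i, j}\<close>, \<open>i < j\<close>, of the Dynkin diagram, without multiplicities.\<close>

fun dynkin_edge :: "lie_type \<Rightarrow> nat \<Rightarrow> nat \<Rightarrow> bool" where
  "dynkin_edge (Type_D l) i j \<longleftrightarrow> (j = i + 1 \<and> j \<le> l - 1) \<or> (i = l - 2 \<and> j = l)"
| "dynkin_edge (Type_E l) i j \<longleftrightarrow> (i, j) \<in> {(1, 2), (2, 3), (3, 4), (3, 5)} \<or> (5 \<le> i \<and> j = i + 1)"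
| "dynkin_edge g i j \<longleftrightarrow> j = i + 1"

text \<open>
  For adjacent \<open>i \<noteq> j\<close> one has \<open>(\<alpha>\<^sub>i, \<alpha>\<^sub>j) = - max d\<^sub>i d\<^sub>j\<close>, hence
  \<open>C\<^sub>i\<^sub>j = 2 (\<alpha>\<^sub>i, \<alpha>\<^sub>j) / (\<alpha>\<^sub>i, \<alpha>\<^sub>i) = - max d\<^sub>i d\<^sub>j / d\<^sub>i\<close>.
\<close>

definition cartan_matrix :: "lie_type \<Rightarrow> nat \<Rightarrow> nat \<Rightarrow> rat" where
  "cartan_matrix g i j =
     (if i = j then 2
      else if dynkin_edge g i j \<or> dynkin_edge g j i
        then - max (half_norm g i) (half_norm g j) / half_norm g i
      else 0)"


section \<open>The rational function field\<close>

text \<open>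
  Variables are labelled by pairs \<open>(i, n)\<close>. The linear order on them (lexicographic) has no
  mathematical meaning; it makes the library recognize the polynomial ring as an integral domain.
\<close>

datatype variable = Variable (var_vertex: nat) (var_arg: rat)

instantiation variable :: linorder
begin

definition less_eq_variable :: "variable \<Rightarrow> variable \<Rightarrow> bool" where
  "less_eq_variable v w \<longleftrightarrow>
     var_vertex v < var_vertex w \<or> (var_vertex v = var_vertex w \<and> var_arg v \<le> var_arg w)"

definition less_variable :: "variable \<Rightarrow> variable \<Rightarrow> bool" where
  "less_variable v w \<longleftrightarrow>
     var_vertex v < var_vertex w \<or> (var_vertex v = var_vertex w \<and> var_arg v < var_arg w)"

instance
  by standard (auto simp: less_eq_variable_def less_variable_def intro: variable.expand)

end

type_synonym polynomials = "(variable \<Rightarrow>\<^sub>0 nat) \<Rightarrow>\<^sub>0 complex"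
type_synonym ratfun = "polynomials fract"

abbreviation ratfun_ring :: "ratfun ring" where
  "ratfun_ring \<equiv> ring_of_type_algebra"

definition ratfun_const :: "complex \<Rightarrow> ratfun" where
  "ratfun_const c = Fract (Poly_Mapping.single 0 c) 1"

definition ratfun_var :: "variable \<Rightarrow> ratfun" where
  "ratfun_var v = Fract (Poly_Mapping.single (Poly_Mapping.single v 1) 1) 1"

text \<open>The subfield \<open>K(S)\<close>.\<close>

definition adjoin :: "ratfun set \<Rightarrow> ratfun set \<Rightarrow> ratfun set" where
  "adjoin K S = generate_field ratfun_ring (K \<union> S)"

text \<open>
  An element of \<open>d\<int> / d'm\<int>\<close> is represented by its representative in the interval from \<open>0\<close>
  (included) to \<open>d'm\<close> (excluded). The functions below take an arbitrary argument \<open>n \<in> d\<int>\<close>, and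
  \<open>yv\<close> reduces it modulo \<open>d'm\<close>.
\<close>

definition period :: "lie_type \<Rightarrow> nat \<Rightarrow> rat" where
  "period g m = max_half_norm g * of_nat m"

definition residues :: "lie_type \<Rightarrow> nat \<Rightarrow> rat set" where
  "residues g m = {n. 0 \<le> n \<and> n < period g m \<and> n / min_half_norm g \<in> \<int>}"

text \<open>\<open>y\<^sub>i(n)\<close>, with \<open>y\<^sub>0(n) = y\<^sub>l\<^sub>+\<^sub>1(n) = 1\<close> for \<open>l\<close> the rank.\<close>

definition yv :: "lie_type \<Rightarrow> nat \<Rightarrow> nat \<Rightarrow> rat \<Rightarrow> ratfun" where
  "yv g m i n =
     (if i \<in> index_set g
      then ratfun_var (Variable i (n - period g m * of_int \<lfloor>n / period g m\<rfloor>))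
      else 1)"

definition Y_field :: "lie_type \<Rightarrow> nat \<Rightarrow> ratfun set" where
  "Y_field g m = adjoin (range ratfun_const) {yv g m i n | i n. i \<in> index_set g \<and> n \<in> residues g m}"

definition Fv :: "lie_type \<Rightarrow> nat \<Rightarrow> nat \<Rightarrow> rat \<Rightarrow> ratfun" where
  "Fv g m i n =
     (if (\<exists>l. g = Type_B l \<and> i = l) \<or> (g = Type_F4 \<and> i = 3) then
        yv g m (i - 1) (n + 1/2) * yv g m (i + 1) n
      else if (\<exists>l. g = Type_B l \<and> i = l - 1) \<or> (g = Type_F4 \<and> i = 2) then
        yv g m (i - 1) (n + 1) * yv g m (i + 1) n * yv g m (i + 1) (n + 1/2)
      else if (\<exists>l. g = Type_C l \<and> i = l) then
        yv g m (i - 1) (n + 1) * yv g m (i - 1) (n + 2)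
      else if g = Type_G2 \<and> i = 2 then
        yv g m 1 (n + 1) * yv g m 1 (n + 2) * yv g m 1 (n + 3)
      else
        (\<Prod>j\<in>{j \<in> index_set g. j < i \<and> cartan_matrix g i j \<noteq> 0}. yv g m j (n + half_norm g j)) *
        (\<Prod>j\<in>{j \<in> index_set g. j > i \<and> cartan_matrix g i j \<noteq> 0}. yv g m j n))"

definition Xv :: "lie_type \<Rightarrow> nat \<Rightarrow> nat \<Rightarrow> rat \<Rightarrow> ratfun" where
  "Xv g m i n = Fv g m i n / (yv g m i n * yv g m i (n + half_norm g i))"

text \<open>The quotient \<open>d'm / d\<^sub>i\<close> is an integer, and at least \<open>2\<close> when \<open>m > 1\<close>.\<close>

definition Pv :: "lie_type \<Rightarrow> nat \<Rightarrow> nat \<Rightarrow> rat \<Rightarrow> ratfun" where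
  "Pv g m i n =
     1 + (\<Sum>k = 0..nat \<lfloor>period g m / half_norm g i\<rfloor> - 2.
            \<Prod>a = 0..k. Xv g m i (n - half_norm g i * of_nat a))"


section \<open>The action of the simple reflections\<close>

definition Y_ring :: "lie_type \<Rightarrow> nat \<Rightarrow> ratfun ring" where
  "Y_ring g m = ratfun_ring\<lparr>carrier := Y_field g m\<rparr>"

definition Y_automorphisms :: "lie_type \<Rightarrow> nat \<Rightarrow> (ratfun \<Rightarrow> ratfun) set" where
  "Y_automorphisms g m =
     {r \<in> extensional (Y_field g m).
        r \<in> ring_iso (Y_ring g m) (Y_ring g m) \<and> (\<forall>c. r (ratfun_const c) = ratfun_const c)}"

text \<open>
  \<open>r\<^sub>i\<close> as the unique \<open>\<complex>\<close>-algebra automorphism of \<open>Y_field g m\<close> with the prescribed values on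
  the generators.
\<close>

definition simple_reflection :: "lie_type \<Rightarrow> nat \<Rightarrow> nat \<Rightarrow> ratfun \<Rightarrow> ratfun" where
  "simple_reflection g m i =
     (THE r. r \<in> Y_automorphisms g m \<and>
        (\<forall>n \<in> residues g m.
           r (yv g m i n) =
             Pv g m i (n - 2 * half_norm g i) / Pv g m i (n - half_norm g i)
               * yv g m i n * Xv g m i (n - half_norm g i)) \<and>
        (\<forall>j \<in> index_set g - {i}. \<forall>n \<in> residues g m. r (yv g m j n) = yv g m j n))"

definition Y_invariants :: "lie_type \<Rightarrow> nat \<Rightarrow> nat \<Rightarrow> ratfun set" where
  "Y_invariants g m i = {f \<in> Y_field g m. simple_reflection g m i f = f}"


section \<open>Subfields\<close>

definition zv :: "lie_type \<Rightarrow> nat \<Rightarrow> nat \<Rightarrow> rat \<Rightarrow> ratfun" where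
  "zv g m i n = yv g m i n + Fv g m i n / yv g m i (n + half_norm g i)"

definition Z_field :: "lie_type \<Rightarrow> nat \<Rightarrow> nat \<Rightarrow> ratfun set" where
  "Z_field g m i =
     adjoin (range ratfun_const)
       ({zv g m i n | n. n \<in> residues g m} \<union>
        {yv g m j n | j n. j \<in> index_set g - {i} \<and> n \<in> residues g m})"

text \<open>The classes \<open>N\<^sub>i\<^sub>,\<^sub>s = (d\<^sub>i\<int> + (s-1)d) / d'm\<int>\<close>.\<close>

definition residue_class :: "lie_type \<Rightarrow> nat \<Rightarrow> nat \<Rightarrow> nat \<Rightarrow> rat set" where
  "residue_class g m i s =
     {n \<in> residues g m. (n - (of_nat s - 1) * min_half_norm g) / half_norm g i \<in> \<int>}"

definition delta :: "lie_type \<Rightarrow> nat \<Rightarrow> nat \<Rightarrow> nat \<Rightarrow> ratfun" where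
  "delta g m i s =
     (let y = \<Prod>n\<in>residue_class g m i s. yv g m i n;
          F = \<Prod>n\<in>residue_class g m i s. Fv g m i n
      in y - F / y)"

text \<open>
  When \<open>\<alpha>\<^sub>i\<close> is not a shortest root, \<open>d\<^sub>i\<close> is \<open>2d\<close> or \<open>3d\<close>; the second branch is the case \<open>3d\<close>.
\<close>

definition Z_field' :: "lie_type \<Rightarrow> nat \<Rightarrow> nat \<Rightarrow> ratfun set" where
  "Z_field' g m i =
     (if half_norm g i = 2 * min_half_norm g
      then adjoin (Z_field g m i) {delta g m i 1 * delta g m i 2}
      else adjoin (Z_field g m i)
             {delta g m i 1 * delta g m i 2, delta g m i 2 * delta g m i 3})"

end

theory Submission
  imports Defs
begin

text \<open>
  Fix \<open>i\<close> and one class \<open>n + d\<^sub>i\<int>\<close>. The relation \<open>y\<^sub>i(n) = z\<^sub>i(n) - F\<^sub>i(n) / y\<^sub>i(n + d\<^sub>i)\<close> is a cyclic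
  continued fraction, so that \<open>y\<^sub>i(n)\<close> is a fixed point of a Moebius transformation with coefficients
  in the field \<open>Z\<close> generated by the \<open>z\<^sub>i\<close> and the \<open>y\<^sub>j\<close>, \<open>j \<noteq> i\<close>. It is quadratic over \<open>Z\<close>, and
  \<open>r\<^sub>i(y\<^sub>i(n))\<close> is the other fixed point. The eigenvalues of the monodromy matrix are \<open>y\<^sub>s\<close> and
  \<open>F\<^sub>s / y\<^sub>s\<close>, the products of \<open>y\<^sub>i\<close> and of \<open>F\<^sub>i / y\<^sub>i\<close> over the class; hence \<open>\<delta>\<^sub>s\<close> is a square root of the discriminant, \<open>r\<^sub>i(\<delta>\<^sub>s) = - \<delta>\<^sub>s\<close>, and the class of
  \<open>s\<close> generates \<open>Z(\<delta>\<^sub>s)\<close>. Adjoining to \<open>Z\<close> the products of two \<open>\<delta>\<^sub>s\<close> gives a field of invariants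
  over which the whole function field is quadratic, generated by \<open>\<delta>\<^sub>1\<close>, so it contains all invariants.
  The degrees follow because each class can be flipped separately from the others.
\<close>

section \<open>Specialization of rational functions\<close>

definition monomial_eval :: "('x \<Rightarrow> 'k::comm_monoid_mult) \<Rightarrow> ('x \<Rightarrow>\<^sub>0 nat) \<Rightarrow> 'k" where
  "monomial_eval v e = (\<Prod>x\<in>Poly_Mapping.keys e. v x ^ Poly_Mapping.lookup e x)"

definition poly_eval ::
  "('a::zero \<Rightarrow> 'k::comm_semiring_1) \<Rightarrow> ('x \<Rightarrow> 'k) \<Rightarrow> (('x \<Rightarrow>\<^sub>0 nat) \<Rightarrow>\<^sub>0 'a) \<Rightarrow> 'k" where
  "poly_eval c v p = (\<Sum>e\<in>Poly_Mapping.keys p. c (Poly_Mapping.lookup p e) * monomial_eval v e)"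

lemma monomial_eval_add: "monomial_eval v (e + e') = monomial_eval v e * monomial_eval v e'"
proof -
  have eq: "monomial_eval v e'' =
      (\<Prod>x\<in>Poly_Mapping.keys e \<union> Poly_Mapping.keys e'. v x ^ Poly_Mapping.lookup e'' x)"
    if "Poly_Mapping.keys e'' \<subseteq> Poly_Mapping.keys e \<union> Poly_Mapping.keys e'" for e''
    unfolding monomial_eval_def
    by (rule prod.mono_neutral_left) (use that in \<open>auto simp: in_keys_iff\<close>)
  show ?thesis
    using keys_add[of e e'] by (simp add: eq lookup_add power_add prod.distrib)
qed

lemma monomial_eval_single [simp]: "monomial_eval v (Poly_Mapping.single x n) = v x ^ n"
  by (simp add: monomial_eval_def)

lemma monomial_eval_0 [simp]: "monomial_eval v 0 = 1"
  by (simp add: monomial_eval_def)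

text \<open>Additive induction from single terms: multiplicativity of evaluation and its
  compatibility with \<open>Fract\<close> become statements about monomials.\<close>

lemma poly_induct [case_names single add]:
  fixes p :: polynomials
  assumes "\<And>e a. P (Poly_Mapping.single e a)" and "\<And>p q. P p \<Longrightarrow> P q \<Longrightarrow> P (p + q)"
  shows "P p"
proof (induction p rule: update_induct)
  case const
  show ?case using assms(1)[of 0 0] by simp
next
  case (update f e b)
  have "Poly_Mapping.update e b f = f + Poly_Mapping.single e b"
    using update(1) by (intro poly_mapping_eqI)
      (auto simp: lookup_update lookup_add lookup_single in_keys_iff when_def)
  then show ?case using assms update(3) by metis
qed

text \<open>Two kinds of instance occur: \<open>c\<close> the identity and \<open>v\<close> a
  complex point, to test that a function does not vanish; and \<open>c = ratfun_const\<close> with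
  rational functions for \<open>v\<close>, to build field automorphisms.\<close>

locale specialization =
  fixes c :: "complex \<Rightarrow> 'k::field" and v :: "variable \<Rightarrow> 'k"
  assumes c_1: "c 1 = 1"
    and c_add: "c (a + b) = c a + c b"
    and c_mult: "c (a * b) = c a * c b"
begin

lemma c_0: "c 0 = 0"
  using c_add[of 0 0] add_cancel_right_right[of "c 0" "c 0"] by simp

abbreviation pe :: "polynomials \<Rightarrow> 'k" where
  "pe \<equiv> poly_eval c v"

lemma pe_single [simp]: "pe (Poly_Mapping.single e a) = c a * monomial_eval v e"
  by (simp add: poly_eval_def c_0)

lemma pe_0 [simp]: "pe 0 = 0"
  by (simp add: poly_eval_def)

lemma pe_1 [simp]: "pe 1 = 1"
  by (simp add: c_1 flip: single_one)

lemma pe_add: "pe (p + q) = pe p + pe q"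
  unfolding poly_eval_def by (rule setsum_keys_plus_distrib) (simp_all add: c_0 c_add ring_distribs)

lemma pe_uminus: "pe (- p) = - pe p"
  using pe_add[of p "- p"] by (simp add: eq_neg_iff_add_eq_0 add.commute)

lemma pe_mult: "pe (p * q) = pe p * pe q"
proof (induction p rule: poly_induct)
  case (single e a)
  show ?case
    by (induction q rule: poly_induct)
      (simp_all add: mult_single pe_add c_mult monomial_eval_add algebra_simps)
qed (simp add: pe_add ring_distribs)

text \<open>A relation, because a fraction has a value only when some representation of it keeps a
  nonzero denominator after specialization.\<close>

definition evaluates :: "ratfun \<Rightarrow> 'k \<Rightarrow> bool" where
  "evaluates f w \<longleftrightarrow> (\<exists>a b. pe b \<noteq> 0 \<and> f = Fract a b \<and> w = pe a / pe b)"

lemma evaluatesE: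
  assumes "evaluates f w"
  obtains a b where "pe b \<noteq> 0" "b \<noteq> 0" "f = Fract a b" "w = pe a / pe b"
  using assms unfolding evaluates_def by (metis pe_0)

lemma evaluates_unique:
  assumes "evaluates f w" "evaluates f w'"
  shows "w = w'"
proof -
  obtain a b where 1: "pe b \<noteq> 0" "b \<noteq> 0" "f = Fract a b" "w = pe a / pe b"
    using assms(1) by (rule evaluatesE)
  obtain a' b' where 2: "pe b' \<noteq> 0" "b' \<noteq> 0" "f = Fract a' b'" "w' = pe a' / pe b'"
    using assms(2) by (rule evaluatesE)
  have "a * b' = a' * b"
    using 1 2 by (simp add: eq_fract)
  then have "pe a * pe b' = pe a' * pe b"
    by (metis pe_mult)
  then show ?thesis
    using 1(1,4) 2(1,4) by (simp add: frac_eq_eq)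
qed

lemma evaluates_poly: "evaluates (Fract p 1) (pe p)"
  unfolding evaluates_def by (intro exI[of _ p] exI[of _ 1]) simp

lemma evaluates_const [simp]: "evaluates (ratfun_const a) (c a)"
  using evaluates_poly[of "Poly_Mapping.single 0 a"] by (simp add: ratfun_const_def)

lemma evaluates_var [simp]: "evaluates (ratfun_var x) (v x)"
  using evaluates_poly[of "Poly_Mapping.single (Poly_Mapping.single x 1) 1"]
  by (simp add: ratfun_var_def c_1)

lemma evaluates_1 [simp]: "evaluates 1 1"
  using evaluates_poly[of 1] by (simp flip: One_fract_def)

lemma evaluates_0 [simp]: "evaluates 0 0"
  using evaluates_poly[of 0] by (simp flip: Zero_fract_def)

lemma evaluates_add:
  assumes "evaluates f w" "evaluates f' w'"
  shows "evaluates (f + f') (w + w')"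
proof -
  obtain a b where 1: "pe b \<noteq> 0" "b \<noteq> 0" "f = Fract a b" "w = pe a / pe b"
    using assms(1) by (rule evaluatesE)
  obtain a' b' where 2: "pe b' \<noteq> 0" "b' \<noteq> 0" "f' = Fract a' b'" "w' = pe a' / pe b'"
    using assms(2) by (rule evaluatesE)
  show ?thesis
    unfolding evaluates_def using 1 2
    by (intro exI[of _ "a * b' + a' * b"] exI[of _ "b * b'"])
      (simp add: pe_mult pe_add add_frac_eq)
qed

lemma evaluates_mult:
  assumes "evaluates f w" "evaluates f' w'"
  shows "evaluates (f * f') (w * w')"
proof -
  obtain a b where 1: "pe b \<noteq> 0" "b \<noteq> 0" "f = Fract a b" "w = pe a / pe b"
    using assms(1) by (rule evaluatesE)
  obtain a' b' where 2: "pe b' \<noteq> 0" "b' \<noteq> 0" "f' = Fract a' b'" "w' = pe a' / pe b'"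
    using assms(2) by (rule evaluatesE)
  show ?thesis
    unfolding evaluates_def using 1 2
    by (intro exI[of _ "a * a'"] exI[of _ "b * b'"]) (simp add: pe_mult)
qed

lemma evaluates_uminus:
  assumes "evaluates f w"
  shows "evaluates (- f) (- w)"
proof -
  obtain a b where 1: "pe b \<noteq> 0" "b \<noteq> 0" "f = Fract a b" "w = pe a / pe b"
    using assms by (rule evaluatesE)
  then show ?thesis
    unfolding evaluates_def by (intro exI[of _ "- a"] exI[of _ b]) (simp add: pe_uminus)
qed

lemma evaluates_inverse:
  assumes "evaluates f w" "w \<noteq> 0"
  shows "evaluates (inverse f) (inverse w)"
proof -
  obtain a b where 1: "pe b \<noteq> 0" "b \<noteq> 0" "f = Fract a b" "w = pe a / pe b"
    using assms(1) by (rule evaluatesE)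
  then show ?thesis
    using assms(2) unfolding evaluates_def by (intro exI[of _ b] exI[of _ a]) simp
qed

lemma evaluates_divide:
  "evaluates f w \<Longrightarrow> evaluates f' w' \<Longrightarrow> w' \<noteq> 0 \<Longrightarrow> evaluates (f / f') (w / w')"
  by (simp add: divide_inverse evaluates_mult evaluates_inverse)

lemma evaluates_sum:
  "(\<And>x. x \<in> A \<Longrightarrow> evaluates (f x) (w x)) \<Longrightarrow> evaluates (sum f A) (sum w A)"
  by (induction A rule: infinite_finite_induct) (auto intro: evaluates_add)

lemma evaluates_prod:
  "(\<And>x. x \<in> A \<Longrightarrow> evaluates (f x) (w x)) \<Longrightarrow> evaluates (prod f A) (prod w A)"
  by (induction A rule: infinite_finite_induct) (auto intro: evaluates_mult)

text \<open>The test for nonvanishing in the function field: one specialization with nonzero value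
  suffices.\<close>

lemma evaluates_nonzero: "evaluates f w \<Longrightarrow> w \<noteq> 0 \<Longrightarrow> f \<noteq> 0"
  using evaluates_unique evaluates_0 by blast

definition subst :: "ratfun \<Rightarrow> 'k" where
  "subst f = (THE w. evaluates f w)"

lemma substI: "evaluates f w \<Longrightarrow> subst f = w"
  unfolding subst_def by (rule the_equality) (auto intro: evaluates_unique)

lemma evaluates_power: "evaluates f w \<Longrightarrow> evaluates (f ^ n) (w ^ n)"
  by (induction n) (auto intro: evaluates_mult)

lemma evaluates_monomial_eval:
  "(\<And>x. evaluates (u x) (w x)) \<Longrightarrow> evaluates (monomial_eval u e) (monomial_eval w e)"
  unfolding monomial_eval_def by (intro evaluates_prod evaluates_power) simp

end

section \<open>Substitution of rational functions for the variables\<close>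

lemma specialization_id: "specialization (\<lambda>a. a)"
  by standard auto

lemma specialization_ratfun_const: "specialization ratfun_const"
  by standard
    (simp_all add: ratfun_const_def single_add mult_single flip: fract_collapse(2))

text \<open>Substituting each variable for itself is the identity. This writes a polynomial as an
  expression in constants and variables inside the field, so that a substitution can be followed
  through it.\<close>

lemma Fract_eq_poly_eval: "Fract p 1 = poly_eval ratfun_const ratfun_var p"
proof -
  interpret specialization ratfun_const ratfun_var
    by (rule specialization_ratfun_const)
  have mon: "Fract (Poly_Mapping.single e 1) 1 = monomial_eval ratfun_var e" for e
  proof (induction e rule: update_induct)
    case const
    show ?case by (simp add: fract_collapse)
  next
    case (update e x n)
    have pow: "ratfun_var x ^ n = Fract (Poly_Mapping.single (Poly_Mapping.single x n) 1) 1"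
    proof (induction n)
      case 0
      show ?case by (simp add: fract_collapse)
    next
      case (Suc n)
      then show ?case
        by (simp add: ratfun_var_def mult_single flip: single_add)
    qed
    have "Poly_Mapping.update x n e = e + Poly_Mapping.single x n"
      using update(1) by (intro poly_mapping_eqI)
        (auto simp: lookup_update lookup_add lookup_single in_keys_iff when_def)
    then show ?case
      using update(3) by (simp add: monomial_eval_add pow mult_single flip: update(3))
  qed
  show ?thesis
  proof (induction p rule: poly_induct)
    case (single e a)
    show ?case
      by (simp add: mult_single flip: mon) (simp add: ratfun_const_def mult_single)
  next
    case (add p q)
    have "Fract (p + q) 1 = Fract p 1 + Fract q 1"
      by simp
    then show ?case
      by (simp only: pe_add add)
  qed
qed

text \<open>
  The involutivity hypothesis makes a substitution injective on polynomials, so that it extends to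
  the whole field of rational functions.
\<close>

locale involutive_substitution =
  fixes v :: "variable \<Rightarrow> ratfun"
  assumes involutive: "specialization.evaluates ratfun_const v (v x) (ratfun_var x)"
begin

sublocale specialization ratfun_const v
  by (rule specialization_ratfun_const)

text \<open>Substituting twice gives the polynomial back: \<open>pe p\<close> is an expression in
  the \<open>v x\<close>, and each \<open>v x\<close> evaluates to its variable.\<close>

lemma evaluates_pe: "evaluates (pe p) (Fract p 1)"
  unfolding Fract_eq_poly_eval unfolding poly_eval_def
  by (intro evaluates_sum evaluates_mult evaluates_const evaluates_monomial_eval involutive)

text \<open>The second substitution recovers \<open>p\<close> from \<open>pe p\<close>, so
  \<open>pe p\<close> cannot vanish. Hence no denominator is lost and \<open>subst\<close> has a
  meaning on every fraction.\<close>

lemma pe_nonzero: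
  assumes "p \<noteq> 0"
  shows "pe p \<noteq> 0"
proof -
  have "Fract p 1 \<noteq> 0"
    using assms by (simp add: Zero_fract_def eq_fract)
  then show ?thesis
    using evaluates_pe[of p] evaluates_nonzero by blast
qed

lemma evaluates_subst [simp]: "evaluates f (subst f)"
proof (cases f)
  case (Fract a b)
  then have "evaluates f (pe a / pe b)"
    unfolding evaluates_def using pe_nonzero by blast
  then show ?thesis using substI by metis
qed

lemma subst_add: "subst (f + h) = subst f + subst h"
  by (intro substI evaluates_add evaluates_subst)

lemma subst_mult: "subst (f * h) = subst f * subst h"
  by (intro substI evaluates_mult evaluates_subst)

lemma subst_uminus: "subst (- f) = - subst f"
  by (intro substI evaluates_uminus evaluates_subst)

lemma subst_0 [simp]: "subst 0 = 0" and subst_1 [simp]: "subst 1 = 1"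
  and subst_const [simp]: "subst (ratfun_const a) = ratfun_const a"
  and subst_var [simp]: "subst (ratfun_var x) = v x"
  by (intro substI; simp)+

lemma subst_subst [simp]: "subst (subst f) = f"
proof (cases f)
  case (Fract a b)
  have "subst f = pe a / pe b"
    using Fract pe_nonzero unfolding evaluates_def by (intro substI) (auto simp: evaluates_def)
  moreover have "evaluates (pe a / pe b) (Fract a 1 / Fract b 1)"
    using Fract by (intro evaluates_divide evaluates_pe) (simp add: Zero_fract_def eq_fract)
  ultimately show ?thesis
    using Fract by (simp add: substI)
qed

lemma subst_inverse: "subst (inverse f) = inverse (subst f)"
proof (cases "f = 0")
  case False
  then have "subst f \<noteq> 0"
    using subst_subst subst_0 by metis
  then show ?thesis
    by (intro substI evaluates_inverse evaluates_subst)
qed simp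

lemma subst_diff: "subst (f - h) = subst f - subst h"
  using subst_add[of f "- h"] by (simp add: subst_uminus)

lemma subst_divide: "subst (f / h) = subst f / subst h"
  by (simp add: divide_inverse subst_mult subst_inverse)

end

section \<open>Cyclic chains\<close>

text \<open>Models one vertex: \<open>y\<close> and \<open>F\<close> stand for y_i and F_i,
  \<open>h\<close> for d_i, and \<open>N\<close> for the length d'm/d_i of a class. Arguments stay
  unreduced; periodicity replaces arithmetic modulo d'm.\<close>

locale cyclic_chain =
  fixes y F :: "rat \<Rightarrow> 'k::field" and h :: rat and N :: nat
  assumes N_ge_2: "N \<ge> 2"
    and y_periodic: "y (n + h * of_nat N) = y n"
    and F_periodic: "F (n + h * of_nat N) = F n"
    and y_nonzero [simp]: "y n \<noteq> 0"
    and F_nonzero [simp]: "F n \<noteq> 0"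
begin

definition cprod :: "(rat \<Rightarrow> 'k) \<Rightarrow> rat \<Rightarrow> 'k" where
  "cprod f n = (\<Prod>a<N. f (n - h * of_nat a))"

definition W :: "rat \<Rightarrow> 'k" where
  "W n = F n / (y n * y (n + h))"

text \<open>The longest summand has \<open>N - 1\<close> factors, one short of a full turn around
  the class; the full turn is \<open>Q\<close>.\<close>

definition P :: "rat \<Rightarrow> 'k" where
  "P n = 1 + (\<Sum>k = 0..N - 2. \<Prod>a = 0..k. W (n - h * of_nat a))"

definition Q :: "rat \<Rightarrow> 'k" where
  "Q n = cprod W n"

definition z :: "rat \<Rightarrow> 'k" where
  "z n = y n + F n / y (n + h)"

definition r :: "rat \<Rightarrow> 'k" where
  "r n = P (n - 2 * h) / P (n - h) * y n * W (n - h)"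

text \<open>The two windows differ only in their end factors, which lie a full period apart. So
  \<open>cprod f\<close> depends only on the class of \<open>n\<close>.\<close>

lemma cprod_shift:
  assumes "\<And>n. f (n + h * of_nat N) = f n"
  shows "cprod f (n - h) = cprod f n"
proof -
  obtain M where M: "N = Suc M"
    using N_ge_2 by (cases N) auto
  define g where "g a = f (n - h * of_nat a)" for a
  have "g N = g 0"
    using assms[of "n - h * of_nat N"] by (simp add: g_def)
  have "cprod f (n - h) = (\<Prod>a<N. g (Suc a))"
    by (simp add: cprod_def g_def algebra_simps)
  also have "\<dots> = (\<Prod>a<M. g (Suc a)) * g N"
    unfolding M by simp
  also have "\<dots> = (\<Prod>a<Suc M. g a)"
    unfolding \<open>g N = g 0\<close> prod.lessThan_Suc_shift by simp
  finally show ?thesis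
    unfolding M[symmetric] by (simp add: cprod_def g_def)
qed

lemma W_periodic: "W (n + h * of_nat N) = W n"
  using y_periodic[of n] y_periodic[of "n + h"] F_periodic[of n] by (simp add: W_def algebra_simps)

lemma P_periodic: "P (n + h * of_nat N) = P n"
  using W_periodic[of "n - h * of_nat a" for a] by (simp add: P_def algebra_simps)

lemma r_periodic: "r (n + h * of_nat N) = r n"
  using W_periodic[of "n - h"] P_periodic[of "n - h"] P_periodic[of "n - 2 * h"] y_periodic[of n]
  by (simp add: r_def algebra_simps)

lemma W_nonzero [simp]: "W n \<noteq> 0"
  by (simp add: W_def)

lemma Q_shift: "Q (n - h) = Q n"
  unfolding Q_def by (rule cprod_shift) (rule W_periodic)

lemma Q_periodic: "Q (n + h * of_nat N) = Q n"
  using W_periodic[of "n - h * of_nat a" for a] by (simp add: Q_def cprod_def algebra_simps)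

lemma Q_nonzero [simp]: "Q n \<noteq> 0"
  by (simp add: Q_def cprod_def)

lemma cprod_F_nonzero [simp]: "cprod F n \<noteq> 0"
  by (simp add: cprod_def)

lemma cprod_y_nonzero [simp]: "cprod y n \<noteq> 0"
  by (simp add: cprod_def)

lemma cprod_mult: "cprod (\<lambda>n. f n * g n) n = cprod f n * cprod g n"
  by (simp add: cprod_def prod.distrib)

lemma cprod_divide: "cprod (\<lambda>n. f n / g n) n = cprod f n / cprod g n"
  by (simp add: cprod_def prod_dividef)

lemma cprod_arg_shift: "cprod (\<lambda>n. f (n + t)) n = cprod f (n + t)"
  by (simp add: cprod_def algebra_simps)

lemma Q_eq: "Q n = cprod F n / cprod y n ^ 2"
proof -
  have "cprod y (n + h) = cprod y n"
    using cprod_shift[of y "n + h"] y_periodic by simp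
  then show ?thesis
    by (simp add: Q_def W_def[abs_def] cprod_divide cprod_mult cprod_arg_shift power2_eq_square)
qed

text \<open>Multiplying \<open>P (n - h)\<close> by \<open>W n\<close> lengthens every partial
  product by one factor. The longest becomes the full turn \<open>Q n\<close>, which is removed, and
  the empty product 1 is put back.\<close>

lemma P_rec: "P n = W n * P (n - h) + 1 - Q n"
proof -
  obtain M where M: "N = Suc (Suc M)"
    using N_ge_2 by (metis add_2_eq_Suc le_Suc_ex)
  define t where "t k = (\<Prod>a\<le>k. W (n - h * of_nat a))" for k
  have P: "P u = 1 + (\<Sum>k\<le>M. \<Prod>a\<le>k. W (u - h * of_nat a))" for u
    unfolding P_def using M by (simp add: atLeast0AtMost)
  have t_Suc: "W n * (\<Prod>a\<le>k. W (n - h - h * of_nat a)) = t (Suc k)" for k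
    unfolding t_def prod.atMost_Suc_shift by (simp add: algebra_simps)
  have "W n * P (n - h) = t 0 + (\<Sum>k\<le>M. t (Suc k))"
    by (simp add: P ring_distribs sum_distrib_left t_Suc) (simp add: t_def)
  also have "\<dots> = (\<Sum>k\<le>M. t k) + t (Suc M)"
    by (simp flip: sum.atMost_Suc_shift)
  also have "t (Suc M) = Q n"
    unfolding t_def Q_def cprod_def using M by (metis lessThan_Suc_atMost)
  finally show ?thesis
    by (simp add: P t_def)
qed

text \<open>
  The relation \<open>z n = y n + F n / y (n + h)\<close> says that the matrix with rows \<open>(z n, - F n)\<close> and
  \<open>(1, 0)\<close> maps \<open>(y (n + h), 1)\<close> to \<open>y (n + h) (y n, 1)\<close>. Hence \<open>(y n, 1)\<close> is an eigenvector
  of the monodromy matrix, and \<open>cprod y n\<close> the eigenvalue.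
\<close>

lemma monodromy:
  assumes K: "0 \<in> K" "1 \<in> K" "\<And>a b. a \<in> K \<Longrightarrow> b \<in> K \<Longrightarrow> a - b \<in> K"
      "\<And>a b. a \<in> K \<Longrightarrow> b \<in> K \<Longrightarrow> a * b \<in> K"
    and zK: "\<And>a. z (n - h * of_nat a) \<in> K" and FK: "\<And>a. F (n - h * of_nat a) \<in> K"
  obtains c e t where "c \<in> K" "e \<in> K" "t \<in> K"
    "c * y n + e = cprod y n" "cprod y n + cprod F n / cprod y n = t"
proof -
  define p where "p j = (\<Prod>a<j. y (n - h * of_nat a))" for j :: nat
  define q where "q j = (\<Prod>a<j. F (n - h - h * of_nat a))" for j :: nat
  \<comment> \<open>Here \<open>a, b, c, e\<close> are the entries of the product of the first
    \<open>j\<close> matrices, \<open>p j\<close> is the factor by which it stretches the vector,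
    and \<open>q j\<close> is its determinant.\<close>
  have "\<exists>a b c e. a \<in> K \<and> b \<in> K \<and> c \<in> K \<and> e \<in> K \<and> a * y n + b = p j * y (n - h * of_nat j) \<and>
          c * y n + e = p j \<and> a * e - b * c = q j" for j
  proof (induction j)
    case 0
    show ?case
      by (rule exI[of _ 1], rule exI[of _ 0], rule exI[of _ 0], rule exI[of _ 1])
        (simp add: K p_def q_def)
  next
    case (Suc j)
    then obtain a b c e where IH: "a \<in> K" "b \<in> K" "c \<in> K" "e \<in> K"
      "a * y n + b = p j * y (n - h * of_nat j)" "c * y n + e = p j" "a * e - b * c = q j"
      by blast
    define z' F' u w where "z' = z (n - h * of_nat (Suc j))" and "F' = F (n - h * of_nat (Suc j))"
      and "u = y (n - h * of_nat j)" and "w = y (n - h * of_nat (Suc j))"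
    have "z' * u - F' = w * u"
      by (simp add: z'_def F'_def u_def w_def z_def field_simps)
    have "(z' * a - F' * c) * y n + (z' * b - F' * e) = z' * (a * y n + b) - F' * (c * y n + e)"
      by (simp add: algebra_simps)
    also have "\<dots> = p j * (z' * u - F')"
      unfolding IH u_def by (simp add: algebra_simps)
    also have "\<dots> = p (Suc j) * w"
      unfolding \<open>z' * u - F' = w * u\<close> by (simp add: p_def u_def)
    finally have 1: "(z' * a - F' * c) * y n + (z' * b - F' * e) = p (Suc j) * w" .
    have 2: "a * y n + b = p (Suc j)"
      using IH(5) by (simp add: p_def)
    have 3: "(z' * a - F' * c) * b - (z' * b - F' * e) * a = q (Suc j)"
    proof -
      have "(z' * a - F' * c) * b - (z' * b - F' * e) * a = F' * (a * e - b * c)"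
        by (simp add: algebra_simps)
      then show ?thesis
        unfolding IH by (simp add: q_def F'_def algebra_simps)
    qed
    have "z' \<in> K" "F' \<in> K"
      using zK[of "Suc j"] FK[of "Suc j"] by (simp_all add: z'_def F'_def)
    then show ?case
      using 1 2 3 K(3,4) IH(1-4) unfolding w_def
      by (intro exI[of _ "z' * a - F' * c"] exI[of _ "z' * b - F' * e"] exI[of _ a] exI[of _ b])
        simp
  qed
  then obtain a b c e where abce: "a \<in> K" "b \<in> K" "c \<in> K" "e \<in> K"
    "a * y n + b = p N * y (n - h * of_nat N)" "c * y n + e = p N" "a * e - b * c = q N"
    by meson
  have pN: "p N = cprod y n"
    by (simp add: p_def cprod_def)
  have qN: "q N = cprod F n"
    using cprod_shift[of F n] F_periodic by (simp add: q_def cprod_def)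
  have "y (n - h * of_nat N) = y n"
    using y_periodic[of "n - h * of_nat N"] by simp
  then have ab: "b = y n * (cprod y n - a)"
    using abce(5) unfolding pN by (simp add: algebra_simps)
  have e: "e = cprod y n - c * y n"
    using abce(6) unfolding pN by (simp add: algebra_simps)
  \<comment> \<open>After a full turn \<open>cprod y n\<close> is an eigenvalue and
    \<open>cprod F n\<close> the determinant, so the trace \<open>a + e\<close> is the required
    \<open>t\<close>.\<close>
  have "cprod y n * (a + e) = cprod y n * cprod y n + cprod F n"
    unfolding abce(7)[unfolded qN, symmetric] ab e by (simp add: algebra_simps)
  then have "cprod y n + cprod F n / cprod y n = a + e"
    by (simp add: field_simps)
  \<comment> \<open>Only closure under differences is assumed, so the sum is read as
    \<open>a - (0 - e)\<close>.\<close>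
  moreover have "a + e \<in> K"
    using K(3)[OF abce(1) K(3)[OF K(1) abce(4)]] by simp
  ultimately show ?thesis
    using that abce(3,4,6) unfolding pN by blast
qed

end

section \<open>The reflected chain and its involutivity\<close>

locale generic_cyclic_chain = cyclic_chain +
  assumes P_nonzero [simp]: "P n \<noteq> 0"
    and Q_neq_1: "Q n \<noteq> 1"
begin

lemma r_eq: "r n = P (n - 2 * h) * F (n - h) / (P (n - h) * y (n - h))"
  by (simp add: r_def W_def)

lemma r_nonzero [simp]: "r n \<noteq> 0"
  by (simp add: r_def)

text \<open>\<open>refl.f\<close> is the image of \<open>f\<close> under the substitution of \<open>r\<close> for \<open>y\<close>.\<close>

sublocale refl: cyclic_chain r F h N
  by standard (simp_all add: N_ge_2 r_periodic F_periodic)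

text \<open>The factors \<open>P\<close> cancel around the class. What remains is the other
  eigenvalue of the monodromy, so the reflection exchanges the two eigenvalues.\<close>

lemma cprod_r: "cprod r n = cprod F n / cprod y n"
proof -
  have shift: "cprod f (n - h) = cprod f n" if "\<And>n. f (n + h * of_nat N) = f n" for f n
    using that by (rule cprod_shift)
  have "cprod (\<lambda>n. f (n - t)) n = cprod f (n - t)" for f t
    using cprod_arg_shift[of f "- t"] by simp
  then have "cprod r n = cprod P (n - 2 * h) * cprod F (n - h) / (cprod P (n - h) * cprod y (n - h))"
    unfolding r_eq[abs_def] by (simp add: cprod_divide cprod_mult)
  also have "n - 2 * h = (n - h) - h"
    by simp
  also have "cprod P (n - h - h) = cprod P (n - h)"
    by (rule shift[of P, OF P_periodic])
  also have "cprod F (n - h) = cprod F n"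
    by (rule shift[of F, OF F_periodic])
  also have "cprod y (n - h) = cprod y n"
    by (rule shift[of y, OF y_periodic])
  finally show ?thesis
    by (simp add: cprod_def)
qed

lemma refl_W: "refl.W n = P n / (P (n - 2 * h) * W (n - h))"
proof -
  have "n + h - 2 * h = n - h"
    by simp
  then show ?thesis
    by (simp add: refl.W_def r_eq W_def)
qed

lemma refl_Q: "refl.Q n = 1 / Q n"
proof -
  have "refl.Q n = cprod F n / cprod r n ^ 2"
    by (rule refl.Q_eq)
  then show ?thesis
    by (simp add: cprod_r Q_eq power_divide power2_eq_square)
qed

text \<open>Adding the recursions for \<open>P\<close> at \<open>n\<close> and at
  \<open>n - h\<close> cancels \<open>Q\<close>, which is the same at both places; the resulting
  three-term relation is the invariance of \<open>z\<close>.\<close>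

lemma refl_z: "refl.z n = z n"
proof -
  have *: "n + h - 2 * h = n - h" "n + h - h = n" "n - h - h = n - 2 * h" "n - h + h = n"
    by simp_all
  have "W (n - h) * P (n - 2 * h) = P (n - h) - 1 + Q n"
    using P_rec[of "n - h"] Q_shift[of n] by (simp add: *)
  then have "W (n - h) * P (n - 2 * h) + P n = (P (n - h) - 1 + Q n) + (W n * P (n - h) + 1 - Q n)"
    using P_rec[of n] by (simp only:)
  then have rec: "W (n - h) * P (n - 2 * h) + P n = P (n - h) * (1 + W n)"
    by (simp add: algebra_simps)
  have "r (n + h) = P (n - h) * F n / (P n * y n)"
    by (simp add: r_eq *)
  then have "refl.z n = (y n / P (n - h)) * (W (n - h) * P (n - 2 * h) + P n)"
    unfolding refl.z_def r_def[of n] by (simp add: field_simps)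
  also have "\<dots> = z n"
    unfolding rec by (simp add: z_def W_def field_simps)
  finally show ?thesis .
qed

text \<open>Both sides solve \<open>u n = refl.W n * u (n - h) + 1 - refl.Q n\<close>, which has only one solution.\<close>

lemma refl_P: "refl.P n = W n * P (n - h) / Q n"
proof -
  define A where "A n = W n * P (n - h) / Q n" for n
  define D where "D n = refl.P n - A n" for n
  have step: "D n = refl.W n * D (n - h)" for n
  proof -
    have *: "n - h - h = n - 2 * h"
      by simp
    have "A n = refl.W n * A (n - h) + 1 - refl.Q n"
      using P_rec[of n] by (simp add: A_def refl_W refl_Q Q_shift * field_simps)
    then have "D n = (refl.W n * refl.P (n - h) + 1 - refl.Q n) - (refl.W n * A (n - h) + 1 - refl.Q n)"
      unfolding D_def by (simp only: refl.P_rec[of n])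
    then show ?thesis
      by (simp add: D_def algebra_simps)
  qed
  \<comment> \<open>One full turn multiplies \<open>D\<close> by \<open>refl.Q n = 1 / Q n\<close>,
    which is not 1, but periodicity returns \<open>D n\<close>; hence
    \<open>D n = 0\<close>.\<close>
  have "D n = (\<Prod>a<k. refl.W (n - h * of_nat a)) * D (n - h * of_nat k)" for k
  proof (induction k)
    case (Suc k)
    have "n - h * of_nat k - h = n - h * of_nat (Suc k)"
      by (simp add: algebra_simps)
    then have "D (n - h * of_nat k) = refl.W (n - h * of_nat k) * D (n - h * of_nat (Suc k))"
      using step by metis
    then show ?case
      using Suc by (simp only: prod.lessThan_Suc mult.assoc)
  qed simp
  from this[of N] have "D n = refl.Q n * D (n - h * of_nat N)"
    by (simp add: refl.Q_def refl.cprod_def)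
  also have "D (n - h * of_nat N) = D n"
  proof -
    have "D (u + h * of_nat N) = D u" for u
      using P_periodic[of "u - h"]
      by (simp add: D_def A_def refl.P_periodic W_periodic Q_periodic algebra_simps)
    from this[of "n - h * of_nat N"] show ?thesis by simp
  qed
  finally have "D n * (1 - refl.Q n) = 0"
    by (simp add: algebra_simps)
  moreover have "refl.Q n \<noteq> 1"
    using Q_neq_1[of n] by (simp add: refl_Q)
  ultimately show ?thesis
    by (simp add: D_def A_def)
qed

lemma refl_P_nonzero: "refl.P n \<noteq> 0"
  by (simp add: refl_P)

text \<open>The reflection is an involution. With \<open>refl.P\<close> and \<open>refl.W\<close>
  known in closed form, the factors cancel.\<close>

lemma refl_r: "refl.r n = y n"
proof -
  have *: "n - h - h = n - 2 * h" "n - 2 * h - h = n - 3 * h" "n - h - 2 * h = n - 3 * h"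
    "n - 2 * h + h = n - h"
    by simp_all
  have Q2: "Q (n - 2 * h) = Q n"
    using Q_shift[of n] Q_shift[of "n - h"] by (simp add: *)
  show ?thesis
    by (simp add: refl.r_def refl_P refl_W r_eq[of n] * Q2 Q_shift) (simp add: W_def * field_simps)
qed

end

section \<open>Subfields and quadratic extensions\<close>

abbreviation (input) type_ring :: "'a::field ring" where
  "type_ring \<equiv> ring_of_type_algebra"

lemma type_ring_simps [simp]:
  "carrier (type_ring :: 'a::field ring) = UNIV"
  "\<zero>\<^bsub>(type_ring :: 'a::field ring)\<^esub> = 0"
  "\<one>\<^bsub>(type_ring :: 'a::field ring)\<^esub> = 1"
  "(x :: 'a) \<otimes>\<^bsub>type_ring\<^esub> y = x * y"
  "(x :: 'a) \<oplus>\<^bsub>type_ring\<^esub> y = x + y"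
  by (simp_all add: ring_of_type_algebra_def)

lemma type_ring_a_inv [simp]: "\<ominus>\<^bsub>type_ring\<^esub> (x :: 'a::field) = - x"
proof -
  interpret field "type_ring :: 'a ring"
    by (rule field_from_type_algebra)
  show ?thesis
    using minus_equality[of "- x" x] by simp
qed

lemma type_ring_m_inv [simp]:
  assumes "(x :: 'a::field) \<noteq> 0"
  shows "inv\<^bsub>type_ring\<^esub> x = inverse x"
proof -
  interpret field "type_ring :: 'a ring"
    by (rule field_from_type_algebra)
  show ?thesis
    using comm_inv_char[of x "inverse x"] assms by simp
qed

lemma type_subfieldI:
  fixes K :: "'a::field set"
  assumes "1 \<in> K" and "\<And>x y. x \<in> K \<Longrightarrow> y \<in> K \<Longrightarrow> x + y \<in> K"
    and "\<And>x. x \<in> K \<Longrightarrow> - x \<in> K" and "\<And>x y. x \<in> K \<Longrightarrow> y \<in> K \<Longrightarrow> x * y \<in> K"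
    and "\<And>x. x \<in> K \<Longrightarrow> x \<noteq> 0 \<Longrightarrow> inverse x \<in> K"
  shows "subfield K type_ring"
proof -
  interpret field "type_ring :: 'a ring"
    by (rule field_from_type_algebra)
  show ?thesis
    using assms by (intro subfieldI' subringI) auto
qed

locale type_subfield =
  fixes K :: "'a::field set"
  assumes subfield: "subfield K type_ring"
begin

sublocale amb: field "type_ring :: 'a ring"
  by (rule field_from_type_algebra)

lemma one [simp]: "1 \<in> K" and zero [simp]: "0 \<in> K"
  using subfieldE(3)[OF subfield] subringE(2,3)[OF subfieldE(1)[OF subfield]] by simp_all

lemma add: "x \<in> K \<Longrightarrow> y \<in> K \<Longrightarrow> x + y \<in> K"
  and mult: "x \<in> K \<Longrightarrow> y \<in> K \<Longrightarrow> x * y \<in> K"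
  and uminus: "x \<in> K \<Longrightarrow> - x \<in> K"
  using subringE(5-7)[OF subfieldE(1)[OF subfield]] by simp_all

lemma diff: "x \<in> K \<Longrightarrow> y \<in> K \<Longrightarrow> x - y \<in> K"
  using add[of x "- y"] uminus by simp

lemma inverse: "x \<in> K \<Longrightarrow> inverse x \<in> K"
  using amb.subfield_m_inv(1)[OF subfield, of x] by (cases "x = 0") auto

lemma divide: "x \<in> K \<Longrightarrow> y \<in> K \<Longrightarrow> x / y \<in> K"
  by (simp add: divide_inverse mult inverse)

lemma sum: "(\<And>i. i \<in> A \<Longrightarrow> f i \<in> K) \<Longrightarrow> sum f A \<in> K"
  by (induction A rule: infinite_finite_induct) (auto intro: add)

lemma prod: "(\<And>i. i \<in> A \<Longrightarrow> f i \<in> K) \<Longrightarrow> prod f A \<in> K"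
  by (induction A rule: infinite_finite_induct) (auto intro: mult)

lemma numeral: "numeral k \<in> K"
proof -
  have "of_nat n \<in> K" for n
    by (induction n) (auto intro: add)
  then show ?thesis
    by (metis of_nat_numeral)
qed

lemma subfield_quadratic:
  assumes "D * D \<in> K"
  shows "subfield {a + b * D | a b. a \<in> K \<and> b \<in> K} type_ring" (is "subfield ?E _")
proof (rule type_subfieldI)
  have memI: "x \<in> ?E" if "x = a + b * D" "a \<in> K" "b \<in> K" for x a b
    using that by blast
  show "1 \<in> ?E"
    by (rule memI[of _ 1 0]) simp_all
  fix x assume "x \<in> ?E"
  then obtain a b where x: "x = a + b * D" and ab: "a \<in> K" "b \<in> K"
    by blast
  show "- x \<in> ?E"
    by (rule memI[of _ "- a" "- b"]) (simp_all add: x ab uminus)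
  show "inverse x \<in> ?E" if "x \<noteq> 0"
  \<comment> \<open>The conjugate may vanish because \<open>D\<close> is allowed to lie in
    \<open>K\<close>; then \<open>x = 2 * a\<close> is inverted inside \<open>K\<close>. Otherwise
    the norm \<open>n\<close> is used.\<close>
  proof (cases "a - b * D = 0")
    case True
    then have "x = 2 * a"
      by (simp add: x)
    moreover have "inverse (2 * a) \<in> K"
      by (intro inverse mult numeral ab)
    ultimately show ?thesis
      by (intro memI[of _ "inverse (2 * a)" 0]) (simp_all del: inverse_mult_distrib)
  next
    case False
    define n where "n = a * a - b * b * (D * D)"
    have n: "n = x * (a - b * D)"
      by (simp add: n_def x algebra_simps)
    have "n \<in> K"
      unfolding n_def by (intro diff mult ab assms)
    moreover have "inverse x = (a - b * D) / n"
      using False by (simp add: n divide_inverse)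
    then have "inverse x = a / n + (- (b / n)) * D"
      by (simp add: diff_divide_distrib)
    ultimately show ?thesis
      using ab by (intro memI[of _ "a / n" "- (b / n)"]) (auto intro: divide uminus)
  qed
  fix x' assume "x' \<in> ?E"
  then obtain a' b' where x': "x' = a' + b' * D" and ab': "a' \<in> K" "b' \<in> K"
    by blast
  show "x + x' \<in> ?E"
    by (rule memI[of _ "a + a'" "b + b'"]) (simp_all add: x x' ab ab' add algebra_simps)
  show "x * x' \<in> ?E"
    by (rule memI[of _ "a * a' + b * b' * (D * D)" "a * b' + b * a'"])
      (simp add: x x' algebra_simps, (intro add mult ab ab' assms)+)
qed

end

section \<open>Adjunction and degrees of quadratic extensions\<close>

lemma subfield_adjoin: "subfield (adjoin K S) ratfun_ring"
  unfolding adjoin_def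
  by (intro field.generate_field_is_subfield field_from_type_algebra) simp

lemma type_subfield_adjoin: "type_subfield (adjoin K S)"
  by (rule type_subfield.intro) (rule subfield_adjoin)

lemma adjoin_base: "x \<in> K \<Longrightarrow> x \<in> adjoin K S"
  and adjoin_gen: "x \<in> S \<Longrightarrow> x \<in> adjoin K S"
  unfolding adjoin_def by (auto intro: generate_field.incl)

lemma adjoin_least:
  assumes "subfield E ratfun_ring" "K \<subseteq> E" "S \<subseteq> E"
  shows "adjoin K S \<subseteq> E"
  unfolding adjoin_def
  by (intro field.generate_field_min_subfield1 field_from_type_algebra) (use assms in auto)

lemma adjoin_quadratic:
  assumes "subfield K ratfun_ring" "D * D \<in> K"
  shows "adjoin K {D} = {a + b * D | a b. a \<in> K \<and> b \<in> K}"
proof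
  interpret K: type_subfield K
    by (rule type_subfield.intro) (rule assms)
  interpret A: type_subfield "adjoin K {D}"
    by (rule type_subfield_adjoin)
  show "adjoin K {D} \<subseteq> {a + b * D | a b. a \<in> K \<and> b \<in> K}"
  proof (rule adjoin_least)
    show "K \<subseteq> {a + b * D | a b. a \<in> K \<and> b \<in> K}"
      by (force intro: exI[of _ 0])
    show "{D} \<subseteq> {a + b * D | a b. a \<in> K \<and> b \<in> K}"
      by (force intro: exI[of _ 0] exI[of _ 1])
  qed (rule K.subfield_quadratic[OF assms(2)])
  show "{a + b * D | a b. a \<in> K \<and> b \<in> K} \<subseteq> adjoin K {D}"
    by (auto intro!: A.add A.mult intro: adjoin_base adjoin_gen)
qed

text \<open>\<open>K\<close> is one-dimensional over itself, and the line through \<open>D\<close>,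
  which is outside \<open>K\<close>, adds one dimension.\<close>

lemma dimension_adjoin_quadratic:
  assumes "subfield K ratfun_ring" "D * D \<in> K" "D \<notin> K"
  shows "ring.dimension ratfun_ring 2 K (adjoin K {D})"
proof -
  interpret K: type_subfield K
    by (rule type_subfield.intro) (rule assms)
  have "ring.dimension ratfun_ring (Suc 1) K (ring.line_extension ratfun_ring K D K)"
    using assms K.amb.dimension_one[OF assms(1)] by (intro K.amb.Suc_dim) auto
  moreover have "ring.line_extension ratfun_ring K D K = adjoin K {D}"
    by (auto simp: K.amb.line_extension_mem_iff adjoin_quadratic[OF assms(1,2)])
      (metis add.commute)+
  ultimately show ?thesis
    by (simp add: numeral_2_eq_2)
qed

lemma adjoin_adjoin: "adjoin (adjoin K S) T = adjoin K (S \<union> T)"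
proof
  show "adjoin (adjoin K S) T \<subseteq> adjoin K (S \<union> T)"
    by (intro adjoin_least subfield_adjoin) (blast intro: adjoin_base adjoin_gen)+
  show "adjoin K (S \<union> T) \<subseteq> adjoin (adjoin K S) T"
    by (intro adjoin_least subfield_adjoin) (blast intro: adjoin_base adjoin_gen)+
qed

context involutive_substitution
begin

lemma subfield_fixed: "subfield {f. subst f = f} ratfun_ring"
  by (rule type_subfieldI) (simp_all add: subst_add subst_mult subst_uminus subst_inverse)

lemma subst_prod: "subst (prod f A) = (\<Prod>x\<in>A. subst (f x))"
  by (induction A rule: infinite_finite_induct) (simp_all add: subst_mult)

end

lemma ratfun_two_nonzero: "(2 :: ratfun) \<noteq> 0"
proof -
  have "Poly_Mapping.lookup (2 :: polynomials) 0 = 2"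
    by (simp add: lookup_numeral)
  then have "(2 :: polynomials) \<noteq> 0"
    by (metis lookup_zero zero_neq_numeral)
  then have "Fract (2 :: polynomials) 1 \<noteq> 0"
    by (simp add: Zero_fract_def eq_fract)
  moreover have 2: "(2 :: ratfun) = Fract 2 1"
    using of_nat_fract[of 2, where 'a = polynomials] by simp
  ultimately show ?thesis
    unfolding 2 by blast
qed

lemma ratfun_neg_eq_self: "- (f :: ratfun) = f \<longleftrightarrow> f = 0"
  using ratfun_two_nonzero
  by (metis add.right_inverse mult_2 mult_eq_0_iff neg_equal_0_iff_equal)

section \<open>Lie data\<close>

lemma min_half_norm_eqI:
  assumes "\<And>j. j \<in> index_set g \<Longrightarrow> c \<le> half_norm g j" "j \<in> index_set g" "half_norm g j = c"
  shows "min_half_norm g = c"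
  unfolding min_half_norm_def
  by (rule Min_eqI) (use assms in \<open>auto simp: index_set_def\<close>)

lemma max_half_norm_eqI:
  assumes "\<And>j. j \<in> index_set g \<Longrightarrow> half_norm g j \<le> c" "j \<in> index_set g" "half_norm g j = c"
  shows "max_half_norm g = c"
  unfolding max_half_norm_def
  by (rule Max_eqI) (use assms in \<open>auto simp: index_set_def\<close>)

lemma min_half_norm_eq:
  assumes "simple_lie_type g"
  shows "min_half_norm g = (if (\<exists>l. g = Type_B l) \<or> g = Type_F4 then 1/2 else 1)"
  using assms
  \<comment> \<open>The witness is a vertex of a shortest root. In type C, vertex 1 is such a vertex
    because the rank is at least 2.\<close>
  by (intro min_half_norm_eqI[where j = "case g of Type_B l \<Rightarrow> l | Type_F4 \<Rightarrow> 4 | _ \<Rightarrow> 1"])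
    (cases g; force simp: index_set_def)+

lemma max_half_norm_eq:
  assumes "simple_lie_type g"
  shows "max_half_norm g = (if \<exists>l. g = Type_C l then 2 else if g = Type_G2 then 3 else 1)"
  using assms
  by (intro max_half_norm_eqI[where j = "case g of Type_C l \<Rightarrow> l | Type_G2 \<Rightarrow> 2 | _ \<Rightarrow> 1"])
    (cases g; force simp: index_set_def)+

lemma half_norm_multiple_min:
  assumes "simple_lie_type g"
  shows "\<exists>k \<in> {1, 2, 3 :: nat}. half_norm g i = min_half_norm g * of_nat k"
  unfolding min_half_norm_eq[OF assms] by (cases g) auto

lemma max_half_norm_multiple:
  assumes "simple_lie_type g"
  shows "\<exists>k > 0 :: nat. max_half_norm g = half_norm g i * of_nat k"
proof -
  have "max_half_norm g \<in> (\<lambda>k. half_norm g i * of_nat k) ` {1, 2, 3 :: nat}"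
    unfolding max_half_norm_eq[OF assms] by (cases g) auto
  then show ?thesis by auto
qed

text \<open>Captures all that is needed of the case distinction in \<open>Fv\<close>: no variable of
  vertex \<open>i\<close> occurs, and shifts are multiples of d. Periodicity, membership in
  \<open>Z\<close>, the value at the base point and invariance under flips then follow by
  induction.\<close>

inductive neighbour_monomial :: "lie_type \<Rightarrow> nat \<Rightarrow> nat \<Rightarrow> (rat \<Rightarrow> ratfun) \<Rightarrow> bool" for g m i where
  one: "neighbour_monomial g m i (\<lambda>n. 1)"
| var: "j \<in> index_set g \<Longrightarrow> j \<noteq> i \<Longrightarrow>
    neighbour_monomial g m i (\<lambda>n. yv g m j (n + min_half_norm g * of_nat k))"
| mult: "neighbour_monomial g m i u \<Longrightarrow> neighbour_monomial g m i w \<Longrightarrow>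
    neighbour_monomial g m i (\<lambda>n. u n * w n)"

lemma neighbour_monomial_yv:
  assumes "j \<noteq> i" "t = min_half_norm g * of_nat k"
  shows "neighbour_monomial g m i (\<lambda>n. yv g m j (n + t))"
proof (cases "j \<in> index_set g")
  case True
  then show ?thesis using var[of j g i m k] assms by simp
next
  case False
  then show ?thesis using one[of g m i] by (simp add: yv_def)
qed

lemma neighbour_monomial_yv_0:
  assumes "j \<noteq> i"
  shows "neighbour_monomial g m i (yv g m j)"
  using neighbour_monomial_yv[OF assms, of 0 g 0] by simp

lemma neighbour_monomial_prod:
  "finite A \<Longrightarrow> (\<And>j. j \<in> A \<Longrightarrow> neighbour_monomial g m i (u j)) \<Longrightarrow>
    neighbour_monomial g m i (\<lambda>n. \<Prod>j\<in>A. u j n)"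
  by (induction A rule: finite_induct) (auto intro: one mult)

lemma neighbour_monomial_Fv:
  assumes g: "simple_lie_type g" and i: "i \<in> index_set g"
  shows "neighbour_monomial g m i (Fv g m i)"
proof -
  note d = min_half_norm_eq[OF g]
  have i1: "i - 1 \<noteq> i" "i + 1 \<noteq> i"
    using i by (auto simp: index_set_def)
  have yv: "neighbour_monomial g m i (\<lambda>n. yv g m j (n + t))"
    if "j \<noteq> i" "\<exists>k::nat. t = min_half_norm g * of_nat k" for j t
    using that neighbour_monomial_yv by blast
  have half: "\<exists>k::nat. 1/2 = min_half_norm g * of_nat k" if "(\<exists>l. g = Type_B l) \<or> g = Type_F4"
    using that by (auto simp: d intro!: exI[of _ 1])
  \<comment> \<open>Since d is 1/2 or 1, an integer shift \<open>t\<close> amounts to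
    \<open>2 * t\<close> or \<open>t\<close> steps of length d.\<close>
  have nums: "\<exists>k::nat. of_nat t = min_half_norm g * of_nat k" for t
    unfolding d by (rule exI[of _ "if (\<exists>l. g = Type_B l) \<or> g = Type_F4 then 2 * t else t"]) auto
  note nums' = nums[of 1, simplified] nums[of 2, simplified] nums[of 3, simplified]
  note intros = neighbour_monomial.intros yv neighbour_monomial_yv_0
  consider
      (a) "(\<exists>l. g = Type_B l \<and> i = l) \<or> (g = Type_F4 \<and> i = 3)"
    | (b) "\<not> ((\<exists>l. g = Type_B l \<and> i = l) \<or> (g = Type_F4 \<and> i = 3))"
        "(\<exists>l. g = Type_B l \<and> i = l - 1) \<or> (g = Type_F4 \<and> i = 2)"
    | (c) "\<exists>l. g = Type_C l \<and> i = l"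
    | (e) "g = Type_G2 \<and> i = 2"
    | (f) "\<not> ((\<exists>l. g = Type_B l \<and> i = l) \<or> (g = Type_F4 \<and> i = 3))"
        "\<not> ((\<exists>l. g = Type_B l \<and> i = l - 1) \<or> (g = Type_F4 \<and> i = 2))"
        "\<not> (\<exists>l. g = Type_C l \<and> i = l)" "\<not> (g = Type_G2 \<and> i = 2)"
    by blast
  then show ?thesis
  proof cases
    case a
    then have "Fv g m i = (\<lambda>n. yv g m (i - 1) (n + 1/2) * yv g m (i + 1) n)"
      unfolding Fv_def[abs_def] by (simp only: if_True)
    then show ?thesis
      using a half i1 by (auto intro!: intros)
  next
    case b
    then have "Fv g m i =
        (\<lambda>n. yv g m (i - 1) (n + 1) * yv g m (i + 1) n * yv g m (i + 1) (n + 1/2))"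
      unfolding Fv_def[abs_def] by (simp only: if_True if_False)
    then show ?thesis
      using b half nums' i1 by (auto intro!: intros)
  next
    case c
    then have "Fv g m i = (\<lambda>n. yv g m (i - 1) (n + 1) * yv g m (i - 1) (n + 2))"
      unfolding Fv_def[abs_def] by auto
    then show ?thesis
      using nums' i1 by (auto intro!: intros)
  next
    case e
    then have "Fv g m i = (\<lambda>n. yv g m 1 (n + 1) * yv g m 1 (n + 2) * yv g m 1 (n + 3))" "1 \<noteq> i"
      unfolding Fv_def[abs_def] by auto
    then show ?thesis
      using nums' by (auto intro!: intros simp del: One_nat_def)
  next
    case f
    then have "Fv g m i = (\<lambda>n.
        (\<Prod>j\<in>{j \<in> index_set g. j < i \<and> cartan_matrix g i j \<noteq> 0}. yv g m j (n + half_norm g j)) *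
        (\<Prod>j\<in>{j \<in> index_set g. j > i \<and> cartan_matrix g i j \<noteq> 0}. yv g m j n))"
      unfolding Fv_def[abs_def] by (simp only: if_False)
    moreover have "finite (index_set g)"
      by (simp add: index_set_def)
    moreover have "\<exists>k::nat. half_norm g j = min_half_norm g * of_nat k" for j
      using half_norm_multiple_min[OF g] by blast
    ultimately show ?thesis
      by (auto intro!: intros neighbour_monomial_prod)
  qed
qed

section \<open>Arithmetic of the arguments at a fixed vertex\<close>

locale lie_node =
  fixes g :: lie_type and m i :: nat
  assumes simple: "simple_lie_type g" and m_gt_1: "m > 1" and i: "i \<in> index_set g"
begin

abbreviation "d \<equiv> min_half_norm g"
abbreviation "h \<equiv> half_norm g i"
abbreviation "p \<equiv> period g m"

text \<open>\<open>\<rho>\<close> is the number d_i/d of classes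
  \<open>N\<^sub>i\<^sub>,\<^sub>s\<close>, and \<open>N\<close> the number d'm/d_i of elements in
  each. Both quotients turn out to be integers, so the rounding loses nothing.\<close>

definition \<rho> :: nat where "\<rho> = nat \<lfloor>h / d\<rfloor>"
definition N :: nat where "N = nat \<lfloor>p / h\<rfloor>"

lemma d_pos: "d > 0"
  by (simp add: min_half_norm_eq[OF simple])

lemma h_eq: "h = d * of_nat \<rho>" and \<rho>_cases: "\<rho> \<in> {1, 2, 3}"
proof -
  obtain k :: nat where k: "k \<in> {1, 2, 3}" "h = d * of_nat k"
    using half_norm_multiple_min[OF simple] by blast
  then have "\<rho> = k"
    using d_pos by (simp add: \<rho>_def)
  then show "h = d * of_nat \<rho>" "\<rho> \<in> {1, 2, 3}"
    using k by simp_all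
qed

lemma h_pos: "h > 0"
  using d_pos \<rho>_cases by (auto simp: h_eq)

lemma p_eq: "p = h * of_nat N" and N_ge_2: "N \<ge> 2"
proof -
  obtain k :: nat where k: "k > 0" "max_half_norm g = h * of_nat k"
    using max_half_norm_multiple[OF simple] by blast
  have p: "p = h * of_nat (k * m)"
    by (simp add: period_def k)
  then have "p / h = of_nat (k * m)"
    using h_pos by (simp del: of_nat_mult)
  then have N: "N = k * m"
    by (simp add: N_def del: of_nat_mult)
  show "p = h * of_nat N" "N \<ge> 2"
    using p N k m_gt_1 by (auto intro: order_trans[of 2 "1 * m"] mult_le_mono)
qed

lemma p_pos: "p > 0"
  using h_pos N_ge_2 by (simp add: p_eq)

definition red :: "rat \<Rightarrow> rat" where
  "red n = n - p * of_int \<lfloor>n / p\<rfloor>"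

lemma red_shift: "red (n + p * of_int t) = red n"
proof -
  have "(n + p * of_int t) / p = n / p + of_int t"
    using p_pos by (simp add: add_divide_distrib)
  then show ?thesis
    unfolding red_def by (simp add: distrib_left)
qed

lemma red_bounds: "0 \<le> red n" "red n < p"
proof -
  have "red n = p * (n / p - of_int \<lfloor>n / p\<rfloor>)"
    using p_pos by (simp add: red_def right_diff_distrib)
  moreover have "0 \<le> n / p - of_int \<lfloor>n / p\<rfloor>" "n / p - of_int \<lfloor>n / p\<rfloor> < 1"
    using floor_correct[of "n / p"] by linarith+
  ultimately show "0 \<le> red n" "red n < p"
    using p_pos mult_strict_left_mono[of _ 1 p] by auto
qed

lemma red_id: "0 \<le> n \<Longrightarrow> n < p \<Longrightarrow> red n = n"
  using p_pos by (simp add: red_def floor_eq_iff)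

lemma red_red [simp]: "red (red n) = red n"
  by (rule red_id) (rule red_bounds)+

lemma yv_eq: "j \<in> index_set g \<Longrightarrow> yv g m j n = ratfun_var (Variable j (red n))"
  by (simp add: yv_def red_def)

lemma yv_red: "yv g m j (red n) = yv g m j n"
  by (cases "j \<in> index_set g") (simp_all add: yv_eq, simp add: yv_def)

lemma yv_periodic: "yv g m j (n + p) = yv g m j n"
  using red_shift[of n 1] yv_red[of j n] yv_red[of j "n + p"] by simp

definition lattice :: "rat set" where
  "lattice = {n. n / d \<in> \<int>}"

lemma lattice_add: "n \<in> lattice \<Longrightarrow> n' \<in> lattice \<Longrightarrow> n + n' \<in> lattice"
  and lattice_diff: "n \<in> lattice \<Longrightarrow> n' \<in> lattice \<Longrightarrow> n - n' \<in> lattice"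
  by (simp_all add: lattice_def add_divide_distrib diff_divide_distrib)

lemma lattice_d: "d * of_int k \<in> lattice"
  using d_pos by (simp add: lattice_def)

lemma lattice_h: "h * of_int k \<in> lattice"
  using lattice_d[of "of_nat \<rho> * k"] by (simp add: h_eq algebra_simps)

lemma lattice_red: "n \<in> lattice \<Longrightarrow> red n \<in> lattice"
  using lattice_diff[OF _ lattice_h[of "of_nat N * \<lfloor>n / p\<rfloor>"]]
  by (simp add: red_def p_eq mult.assoc)

lemma residues_eq: "residues g m = {n \<in> lattice. 0 \<le> n \<and> n < p}"
  by (auto simp: residues_def lattice_def)

lemma red_residues: "n \<in> lattice \<Longrightarrow> red n \<in> residues g m"
  by (simp add: residues_eq lattice_red red_bounds)

lemma Fv_periodic: "Fv g m i (n + p) = Fv g m i n"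
proof -
  have "u (n + p) = u n" if "neighbour_monomial g m i u" for u
    using that
  proof induction
    case (var j k)
    show ?case
      using yv_periodic[of j "n + d * of_nat k"] by (simp add: algebra_simps)
  qed simp_all
  from this[OF neighbour_monomial_Fv[OF simple i]] show ?thesis .
qed

lemma Fv_mem:
  assumes "type_subfield K" "n \<in> lattice"
    and K: "\<And>j n. j \<in> index_set g \<Longrightarrow> j \<noteq> i \<Longrightarrow> n \<in> residues g m \<Longrightarrow> yv g m j n \<in> K"
  shows "Fv g m i n \<in> K"
proof -
  interpret K: type_subfield K by fact
  have "u n \<in> K" if "neighbour_monomial g m i u" for u
    using that
  proof induction
    case (var j k)
    have "n + d * of_nat k \<in> lattice"
      using lattice_add[OF assms(2) lattice_d[of "of_nat k"]] by simp
    then show ?case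
      using K[OF var red_residues] yv_red by simp
  qed (auto intro: K.mult)
  from this[OF neighbour_monomial_Fv[OF simple i]] show ?thesis .
qed

end

section \<open>Flipping a set of residue classes\<close>

lemma periodic_int:
  fixes f :: "rat \<Rightarrow> 'a" and q :: rat
  assumes "\<And>n. f (n + q) = f n"
  shows "f (n + q * of_int t) = f n"
proof -
  have nat: "f (n + q * of_nat k) = f n" for n k
  proof (induction k)
    case (Suc k)
    then show ?case
      using assms[of "n + q * of_nat k"] by (simp add: algebra_simps)
  qed simp
  show ?thesis
  proof (cases t rule: int_cases2)
    case (nonneg k)
    then show ?thesis using nat by simp
  next
    case (nonpos k)
    then show ?thesis using nat[of "n + q * of_int t" k] by simp
  qed
qed

text \<open>\<open>P n \<noteq> 0\<close> and \<open>Q n \<noteq> 1\<close> hold because they hold at the point \<open>y\<^sub>i = 2\<close>, \<open>y\<^sub>j = 1\<close> for \<open>j \<noteq> i\<close>.\<close>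

definition base_point :: "nat \<Rightarrow> variable \<Rightarrow> complex" where
  "base_point i x = (if var_vertex x = i then 2 else 1)"

context lie_node
begin

interpretation pt: specialization "\<lambda>a. a" "base_point i"
  by (rule specialization_id)

lemma pt_yv: "pt.evaluates (yv g m i n) 2"
  using pt.evaluates_var[of "Variable i (red n)"] by (simp add: yv_eq i base_point_def)

lemma pt_Fv: "pt.evaluates (Fv g m i n) 1"
proof -
  have yv: "pt.evaluates (yv g m j n) 1" if "j \<in> index_set g" "j \<noteq> i" for j n
  proof -
    have "base_point i (Variable j (red n)) = 1"
      using that(2) by (simp add: base_point_def)
    then show ?thesis
      using pt.evaluates_var[of "Variable j (red n)"] by (simp only: yv_eq[OF that(1)])
  qed
  have "pt.evaluates (u n) 1" if "neighbour_monomial g m i u" for u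
    using that
  proof induction
    case one
    show ?case by (rule pt.evaluates_1)
  next
    case (var j k)
    then show ?case by (rule yv)
  next
    case (mult u w)
    then show ?case using pt.evaluates_mult[of "u n" 1 "w n" 1] by (simp only: mult_1)
  qed
  from this[OF neighbour_monomial_Fv[OF simple i]] show ?thesis .
qed

sublocale chain: cyclic_chain "yv g m i" "Fv g m i" h N
proof
  fix n
  show "yv g m i n \<noteq> 0"
    by (rule pt.evaluates_nonzero[OF pt_yv]) simp
  show "Fv g m i n \<noteq> 0"
    by (rule pt.evaluates_nonzero[OF pt_Fv]) simp
qed (simp_all add: N_ge_2 yv_periodic Fv_periodic flip: p_eq)

lemma pt_W: "pt.evaluates (chain.W n) (1 / (2 * 2))"
  unfolding chain.W_def
  by (intro pt.evaluates_divide pt.evaluates_mult pt_Fv pt_yv) simp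

sublocale chain: generic_cyclic_chain "yv g m i" "Fv g m i" h N
proof
  fix n
  have "pt.evaluates (chain.P n) (1 + (\<Sum>k = 0..N - 2. \<Prod>a = 0..k. 1 / (2 * 2)))"
    unfolding chain.P_def
    by (intro pt.evaluates_add pt.evaluates_1 pt.evaluates_sum pt.evaluates_prod pt_W)
  moreover have "1 + (\<Sum>k = 0..N - 2. \<Prod>a = 0..k. 1 / (2 * 2)) \<noteq> (0 :: complex)"
  proof -
    have "1 + (\<Sum>k = 0..N - 2. \<Prod>a = 0..k. 1 / (2 * 2)) > (0 :: real)"
      by (intro add_pos_nonneg sum_nonneg prod_nonneg) auto
    then have "complex_of_real (1 + (\<Sum>k = 0..N - 2. \<Prod>a = 0..k. 1 / (2 * 2))) \<noteq> 0"
      unfolding of_real_eq_0_iff by simp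
    then show ?thesis by simp
  qed
  ultimately show "chain.P n \<noteq> 0"
    by (rule pt.evaluates_nonzero)
  \<comment> \<open>The value 2 for y_i gives \<open>W\<close> the value 1/4 and makes this product
    smaller than 1 in norm; the value 1 would have given exactly 1.\<close>
  have "pt.evaluates (chain.Q n) (\<Prod>a<N. 1 / (2 * 2))"
    unfolding chain.Q_def chain.cprod_def by (intro pt.evaluates_prod pt_W)
  moreover have "norm (\<Prod>a<N. 1 / (2 * 2) :: complex) < norm (1 :: complex)"
    using N_ge_2 by (simp add: norm_power norm_divide power_less_one_iff)
  ultimately show "chain.Q n \<noteq> 1"
    using pt.evaluates_unique[OF pt.evaluates_1, of "\<Prod>a<N. 1 / (2 * 2)"] by fastforce
qed

lemma W_eq: "chain.W = Xv g m i"
  by (simp add: fun_eq_iff chain.W_def Xv_def)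

lemma P_eq: "chain.P = Pv g m i"
  by (simp add: fun_eq_iff chain.P_def Pv_def W_eq flip: N_def)

lemma z_eq: "chain.z = zv g m i"
  by (simp add: fun_eq_iff chain.z_def zv_def)

lemma periodic_red:
  assumes "\<And>n. f (n + p) = f n"
  shows "f (red n) = f n"
  using periodic_int[of f p n "- \<lfloor>n / p\<rfloor>"] assms by (simp add: red_def)

abbreviation base :: "nat \<Rightarrow> rat" where
  "base s \<equiv> (of_nat s - 1) * d"

lemma base_lattice: "base s \<in> lattice"
  using d_pos by (simp add: lattice_def)

text \<open>Walking down from \<open>base s\<close> in steps of \<open>h\<close> and reducing meets
  each representative of the class exactly once in \<open>N\<close> steps.\<close>

lemma prod_residue_class:
  assumes "\<And>n. f (n + p) = f n"
  shows "(\<Prod>n\<in>residue_class g m i s. f n) = chain.cprod f (base s)"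
proof -
  define e where "e a = red (base s - h * of_nat a)" for a :: nat
  have e: "\<exists>t. e a = base s - h * of_int (int a + int N * t)" for a
    unfolding e_def red_def p_eq
    by (rule exI[of _ "\<lfloor>(base s - h * of_nat a) / (h * of_nat N)\<rfloor>"]) (simp add: algebra_simps)
  have "bij_betw e {..<N} (residue_class g m i s)"
    unfolding bij_betw_def
  proof (intro conjI inj_onI equalityI subsetI)
    fix a b assume ab: "a \<in> {..<N}" "b \<in> {..<N}" "e a = e b"
    obtain t u where "e a = base s - h * of_int (int a + int N * t)"
      "e b = base s - h * of_int (int b + int N * u)"
      using e by meson
    then have "int a + int N * t = int b + int N * u"
      using ab(3) h_pos by (simp del: of_int_add of_int_mult)
    then have "int a mod int N = int b mod int N"
      by (metis mod_mult_self2)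
    then show "a = b"
      using ab by simp
  next
    fix n assume "n \<in> e ` {..<N}"
    then obtain a where a: "n = e a" by blast
    obtain t where t: "e a = base s - h * of_int (int a + int N * t)"
      using e by blast
    have "n \<in> residues g m"
      unfolding a e_def using base_lattice lattice_h[of "int a"]
      by (intro red_residues lattice_diff) auto
    moreover have "(n - base s) / h = of_int (- (int a + int N * t))"
      unfolding a t using h_pos by simp
    ultimately show "n \<in> residue_class g m i s"
      unfolding residue_class_def by (metis (no_types, lifting) Ints_of_int mem_Collect_eq)
  next
    fix n assume n: "n \<in> residue_class g m i s"
    then obtain k where k: "(n - base s) / h = of_int k"
      unfolding residue_class_def by (auto elim: Ints_cases)
    \<comment> \<open>The sign comes from \<open>cprod\<close> running downwards from its starting
      point.\<close>
    define a where "a = nat ((- k) mod int N)"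
    have a: "int a = (- k) mod int N" "a < N"
      using N_ge_2 by (auto simp: a_def nat_less_iff)
    have "- k = int N * ((- k) div int N) + int a"
      by (simp add: a)
    then have k': "k = - (int N * ((- k) div int N)) - int a"
      by linarith
    have "n = base s + h * of_int k"
      using k h_pos by (simp add: field_simps)
    also have "\<dots> = (base s - h * of_nat a) + p * of_int (- ((- k) div int N))"
      by (subst k') (simp add: p_eq algebra_simps)
    finally have "red n = e a"
      unfolding e_def by (simp only: red_shift)
    moreover have "red n = n"
      using n by (intro red_id) (auto simp: residue_class_def residues_eq)
    ultimately show "n \<in> e ` {..<N}"
      using a by auto
  qed
  then have "(\<Prod>n\<in>residue_class g m i s. f n) = (\<Prod>a<N. f (e a))"
    by (rule prod.reindex_bij_betw[symmetric])
  also have "\<dots> = chain.cprod f (base s)"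
    unfolding chain.cprod_def e_def using assms by (simp add: periodic_red)
  finally show ?thesis .
qed

text \<open>The difference of the two monodromy eigenvalues, attached to an argument
  \<open>n\<close> so that it can be formed before classes are numbered.\<close>

definition \<delta> :: "rat \<Rightarrow> ratfun" where
  "\<delta> n = chain.cprod (yv g m i) n - chain.cprod (Fv g m i) n / chain.cprod (yv g m i) n"

lemma delta_eq: "delta g m i s = \<delta> (base s)"
  by (simp add: delta_def \<delta>_def Let_def prod_residue_class yv_periodic Fv_periodic)

text \<open>Equal eigenvalues would force \<open>Q n = 1\<close>.\<close>

lemma \<delta>_nonzero: "\<delta> n \<noteq> 0"
proof
  assume "\<delta> n = 0"
  then have "chain.Q n = 1"
    unfolding chain.Q_eq \<delta>_def by (simp add: field_simps power2_eq_square)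
  then show False
    using chain.Q_neq_1 by blast
qed

end

text \<open>
  The substitution below is \<open>r\<^sub>i\<close> when \<open>A\<close> is everything. When \<open>A\<close> is a single class, it changes
  the sign of one of the \<open>\<delta>\<^sub>s\<close> only, which gives their independence over \<open>Z\<close>.
\<close>

locale lie_node_flip = lie_node +
  fixes A :: "rat set"
  assumes A_shift: "n - h \<in> A \<longleftrightarrow> n \<in> A"
begin

lemma A_shift_nat: "n - h * of_nat a \<in> A \<longleftrightarrow> n \<in> A"
proof (induction a)
  case (Suc a)
  then show ?case
    using A_shift[of "n - h * of_nat a"] by (simp add: algebra_simps)
qed simp

lemma A_red: "red n \<in> A \<longleftrightarrow> n \<in> A"
  using periodic_red[of "\<lambda>n. n \<in> A" n] A_shift_nat[of "n + p" N for n] by (simp add: p_eq)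

text \<open>Variables exist for every rational argument. Those of vertex \<open>i\<close> outside
  the interval of representatives never arise as \<open>yv\<close> and stay fixed, so that the
  substitution is an involution on all variables.\<close>

definition flip_var :: "variable \<Rightarrow> ratfun" where
  "flip_var x =
     (if var_vertex x = i \<and> var_arg x \<in> A \<and> 0 \<le> var_arg x \<and> var_arg x < p
      then chain.r (var_arg x) else ratfun_var x)"

sublocale flip: specialization ratfun_const flip_var
  by (rule specialization_ratfun_const)

lemma flip_yv: "flip.evaluates (yv g m i n) (if n \<in> A then chain.r n else yv g m i n)"
proof -
  have "chain.r (red n) = chain.r n"
    using chain.r_periodic by (intro periodic_red) (simp add: p_eq)
  then show ?thesis
    using flip.evaluates_var[of "Variable i (red n)"]
    by (cases "n \<in> A") (simp_all add: flip_var_def yv_eq i A_red red_bounds)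
qed

lemma flip_yv_other:
  assumes "j \<noteq> i"
  shows "flip.evaluates (yv g m j n) (yv g m j n)"
proof (cases "j \<in> index_set g")
  case True
  then show ?thesis
    using flip.evaluates_var[of "Variable j (red n)"] assms by (simp add: flip_var_def yv_eq)
qed (simp add: yv_def)

lemma flip_Fv: "flip.evaluates (Fv g m i n) (Fv g m i n)"
proof -
  have "flip.evaluates (u n) (u n)" if "neighbour_monomial g m i u" for u
    using that by induction (auto intro: flip.evaluates_mult flip_yv_other)
  from this[OF neighbour_monomial_Fv[OF simple i]] show ?thesis .
qed

context
  fixes n assumes n: "n \<in> A"
begin

lemma flip_W: "flip.evaluates (chain.W (n - h * of_nat a)) (chain.refl.W (n - h * of_nat a))"
proof -
  have "n - h * of_nat a \<in> A" "n - h * of_nat a + h \<in> A"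
    using n A_shift_nat A_shift[of "n - h * of_nat a + h"] by simp_all
  then show ?thesis
    unfolding chain.W_def chain.refl.W_def
    using flip_yv[of "n - h * of_nat a"] flip_yv[of "n - h * of_nat a + h"]
    by (intro flip.evaluates_divide flip.evaluates_mult flip_Fv) auto
qed

end

lemma flip_P: "n \<in> A \<Longrightarrow> flip.evaluates (chain.P n) (chain.refl.P n)"
  unfolding chain.P_def chain.refl.P_def
  by (intro flip.evaluates_add flip.evaluates_1 flip.evaluates_sum flip.evaluates_prod flip_W)

text \<open>Substituting into the formula for \<open>chain.r\<close> produces
  \<open>chain.refl.r\<close>, which is \<open>yv g m i\<close> again. This supplies the
  involutivity of the flip.\<close>

lemma flip_r: "n \<in> A \<Longrightarrow> flip.evaluates (chain.r n) (yv g m i n)"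
proof -
  assume n: "n \<in> A"
  then have "n - h \<in> A" "n - 2 * h \<in> A"
    using A_shift_nat[of n 1] A_shift_nat[of n 2] by (simp_all add: mult.commute)
  moreover have "flip.evaluates (yv g m i n) (chain.r n)"
    using flip_yv[of n] n by simp
  moreover have "flip.evaluates (chain.W (n - h)) (chain.refl.W (n - h))"
    using flip_W[OF n, of 1] by simp
  ultimately have "flip.evaluates
      (chain.P (n - 2 * h) / chain.P (n - h) * yv g m i n * chain.W (n - h)) (chain.refl.r n)"
    unfolding chain.refl.r_def
    by (intro flip.evaluates_divide flip.evaluates_mult flip_P chain.refl_P_nonzero)
  then show ?thesis
    by (simp only: chain.refl_r flip: chain.r_def)
qed

sublocale flip: involutive_substitution flip_var
proof
  fix x
  show "flip.evaluates (flip_var x) (ratfun_var x)"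
  proof (cases "var_vertex x = i \<and> var_arg x \<in> A \<and> 0 \<le> var_arg x \<and> var_arg x < p")
    case True
    then have "yv g m i (var_arg x) = ratfun_var x"
      using i by (simp add: yv_eq red_id) (metis variable.collapse)
    then show ?thesis
      using True flip_r[of "var_arg x"] by (simp add: flip_var_def)
  next
    case False
    then have "flip_var x = ratfun_var x"
      by (auto simp: flip_var_def)
    then show ?thesis
      using flip.evaluates_var[of x] by simp
  qed
qed

lemma subst_yv: "flip.subst (yv g m i n) = (if n \<in> A then chain.r n else yv g m i n)"
  and subst_yv_other: "j \<noteq> i \<Longrightarrow> flip.subst (yv g m j n) = yv g m j n"
  and subst_Fv: "flip.subst (Fv g m i n) = Fv g m i n"
  by (intro flip.substI flip_yv flip_yv_other flip_Fv; assumption)+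

text \<open>The arguments \<open>n\<close> and \<open>n + h\<close> lie in the same class, so both
  are flipped or neither is.\<close>

lemma subst_zv: "flip.subst (zv g m i n) = zv g m i n"
proof (cases "n \<in> A")
  case True
  then have "flip.subst (zv g m i n) = chain.refl.z n"
    using A_shift[of "n + h"]
    by (simp add: zv_def chain.refl.z_def flip.subst_add flip.subst_divide subst_yv subst_Fv)
  then show ?thesis
    by (simp add: chain.refl_z z_eq)
next
  case False
  then show ?thesis
    using A_shift[of "n + h"]
    by (simp add: zv_def flip.subst_add flip.subst_divide subst_yv subst_Fv)
qed

text \<open>On a flipped class the two eigenvalues change places; elsewhere both stay.\<close>

lemma subst_\<delta>: "flip.subst (\<delta> n) = (if n \<in> A then - \<delta> n else \<delta> n)"
proof -
  have F: "flip.subst (chain.cprod (Fv g m i) n) = chain.cprod (Fv g m i) n"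
    by (simp add: chain.cprod_def flip.subst_prod subst_Fv)
  have "flip.subst (chain.cprod (yv g m i) n) =
      (if n \<in> A then chain.cprod chain.r n else chain.cprod (yv g m i) n)"
    by (simp add: chain.cprod_def flip.subst_prod subst_yv A_shift_nat)
  then show ?thesis
    by (simp add: \<delta>_def flip.subst_diff flip.subst_divide F chain.cprod_r)
qed

end

section \<open>The invariant field\<close>

text \<open>The elements on which both maps agree form a subfield containing the generators; outside
  \<open>Y_field g m\<close> the maps agree by extensionality.\<close>

lemma Y_automorphisms_eqI:
  assumes r: "r \<in> Y_automorphisms g m" and r': "r' \<in> Y_automorphisms g m"
    and eq: "\<And>j n. j \<in> index_set g \<Longrightarrow> n \<in> residues g m \<Longrightarrow> r (yv g m j n) = r' (yv g m j n)"
  shows "r = r'"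
proof -
  interpret Y: type_subfield "Y_field g m"
    unfolding Y_field_def by (rule type_subfield_adjoin)
  have hom: "s (x + y) = s x + s y" "s (x * y) = s x * s y" "s 1 = 1"
    if "s \<in> Y_automorphisms g m" "x \<in> Y_field g m" "y \<in> Y_field g m" for s x y
    using that by (auto simp: Y_automorphisms_def ring_iso_def ring_hom_def Y_ring_def)
  have hom_uminus: "s (- x) = - s x"
    if "s \<in> Y_automorphisms g m" "x \<in> Y_field g m" for s x
  proof -
    have "s 0 = 0"
      using hom(1)[OF that(1) Y.zero Y.zero] add_cancel_right_right[of "s 0" "s 0"] by simp
    then show ?thesis
      using hom(1)[OF that Y.uminus[OF that(2)]] by (simp add: eq_neg_iff_add_eq_0 add.commute)
  qed
  have hom_inverse: "s (inverse x) = inverse (s x)"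
    if "s \<in> Y_automorphisms g m" "x \<in> Y_field g m" "x \<noteq> 0" for s x
    using hom(2)[OF that(1,2) Y.inverse[OF that(2)]] hom(3)[OF that(1) Y.one Y.one] that(3)
    by (simp add: inverse_unique)
  have "Y_field g m \<subseteq> {x \<in> Y_field g m. r x = r' x}"
  proof (subst Y_field_def, rule adjoin_least)
    show "subfield {x \<in> Y_field g m. r x = r' x} ratfun_ring"
      by (rule type_subfieldI)
        (simp_all add: Y.add Y.mult Y.uminus Y.inverse hom(3)[OF r Y.one Y.one]
          hom(3)[OF r' Y.one Y.one] hom[OF r] hom[OF r'] hom_uminus[OF r]
          hom_uminus[OF r'] hom_inverse[OF r] hom_inverse[OF r'])
    show "range ratfun_const \<subseteq> {x \<in> Y_field g m. r x = r' x}"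
      using r r' by (auto simp: Y_automorphisms_def Y_field_def intro: adjoin_base)
    show "{yv g m j n |j n. j \<in> index_set g \<and> n \<in> residues g m} \<subseteq> {x \<in> Y_field g m. r x = r' x}"
      using eq by (auto simp: Y_field_def intro!: adjoin_gen)
  qed
  then show ?thesis
    using r r' by (intro extensionalityI[of _ "Y_field g m"]) (auto simp: Y_automorphisms_def)
qed

section \<open>The fields \<open>Y\<close> and \<open>Z\<close> and the action of flips on
  them\<close>

context lie_node
begin

abbreviation "Y \<equiv> Y_field g m"
abbreviation "Z \<equiv> Z_field g m i"

sublocale Y: type_subfield Y
  unfolding Y_field_def by (rule type_subfield_adjoin)

sublocale Z: type_subfield Z
  unfolding Z_field_def by (rule type_subfield_adjoin)

lemma yv_Y: "j \<in> index_set g \<Longrightarrow> n \<in> lattice \<Longrightarrow> yv g m j n \<in> Y"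
  unfolding Y_field_def
  by (rule adjoin_gen) (metis (mono_tags, lifting) mem_Collect_eq red_residues yv_red)

lemma yv_Z: "j \<in> index_set g \<Longrightarrow> j \<noteq> i \<Longrightarrow> n \<in> lattice \<Longrightarrow> yv g m j n \<in> Z"
  unfolding Z_field_def
  by (rule adjoin_gen) (use red_residues yv_red in fastforce)

lemma residues_lattice: "n \<in> residues g m \<Longrightarrow> n \<in> lattice"
  by (simp add: residues_eq)

lemma Fv_Y: "n \<in> lattice \<Longrightarrow> Fv g m i n \<in> Y"
  by (rule Fv_mem[OF Y.type_subfield_axioms]) (simp_all add: yv_Y residues_lattice)

lemma Fv_Z: "n \<in> lattice \<Longrightarrow> Fv g m i n \<in> Z"
  by (rule Fv_mem[OF Z.type_subfield_axioms]) (simp_all add: yv_Z residues_lattice)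

lemma zv_Z: "n \<in> lattice \<Longrightarrow> zv g m i n \<in> Z"
proof -
  assume n: "n \<in> lattice"
  have "zv g m i (n + p) = zv g m i n" for n
    using yv_periodic[of i n] yv_periodic[of i "n + h"] Fv_periodic[of n]
    by (simp add: zv_def algebra_simps)
  then have "zv g m i (red n) = zv g m i n"
    by (rule periodic_red)
  moreover have "zv g m i (red n) \<in> Z"
    unfolding Z_field_def using red_residues[OF n] by (intro adjoin_gen) blast
  ultimately show ?thesis by simp
qed

lemma const_Z: "ratfun_const a \<in> Z" and const_Y: "ratfun_const a \<in> Y"
  unfolding Z_field_def Y_field_def by (auto intro: adjoin_base)

lemma lattice_h1: "n \<in> lattice \<Longrightarrow> n + h \<in> lattice" "n \<in> lattice \<Longrightarrow> n - h \<in> lattice"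
  "n \<in> lattice \<Longrightarrow> n - h * of_nat a \<in> lattice"
  using lattice_add[OF _ lattice_h[of 1]] lattice_diff[OF _ lattice_h[of 1]]
    lattice_diff[OF _ lattice_h[of "int a"]] by simp_all

lemma Z_subset_Y: "Z \<subseteq> Y"
proof -
  have "zv g m i n \<in> Y" if "n \<in> residues g m" for n
    unfolding zv_def using that
    by (intro Y.add Y.divide yv_Y Fv_Y i lattice_h1 residues_lattice)
  then show ?thesis
    unfolding Z_field_def
    by (intro adjoin_least Y.subfield) (auto intro: yv_Y const_Y residues_lattice)
qed

lemma r_Y:
  assumes "n \<in> lattice"
  shows "chain.r n \<in> Y"
proof -
  have W: "chain.W n \<in> Y" if "n \<in> lattice" for n
    unfolding chain.W_def using that by (intro Y.divide Y.mult Fv_Y yv_Y i lattice_h1)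
  have P: "chain.P n \<in> Y" if "n \<in> lattice" for n
    unfolding chain.P_def using that by (intro Y.add Y.sum Y.prod Y.one W lattice_h1)
  have "n - 2 * h \<in> lattice"
    using lattice_h1(3)[OF assms, of 2] by (simp add: mult.commute)
  then show ?thesis
    unfolding chain.r_def using assms by (intro Y.mult Y.divide P W yv_Y i lattice_h1)
qed

lemma cprod_F_Z: "n \<in> lattice \<Longrightarrow> chain.cprod (Fv g m i) n \<in> Z"
  unfolding chain.cprod_def by (intro Z.prod Fv_Z lattice_h1)

lemma \<delta>_Y: "n \<in> lattice \<Longrightarrow> \<delta> n \<in> Y"
  unfolding \<delta>_def chain.cprod_def
  by (intro Y.diff Y.divide Y.prod Fv_Y yv_Y i lattice_h1)

lemma \<delta>_shift: "\<delta> (n + h * of_int t) = \<delta> n"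
proof -
  have "\<delta> (n + h) = \<delta> n" for n
    using chain.cprod_shift[of "yv g m i" "n + h"] chain.cprod_shift[of "Fv g m i" "n + h"]
      chain.y_periodic chain.F_periodic by (simp add: \<delta>_def)
  then show ?thesis
    by (rule periodic_int)
qed

lemma \<delta>_base:
  assumes "n \<in> lattice"
  obtains s where "s \<in> {1..\<rho>}" "\<delta> n = \<delta> (base s)"
proof -
  obtain k where "n / d = of_int k"
    using assms by (auto simp: lattice_def elim: Ints_cases)
  then have k: "n = d * of_int k"
    using d_pos by (simp add: field_simps)
  \<comment> \<open>Classes are numbered from 1 and \<open>base s\<close> is
    \<open>(s - 1) * d\<close>, whence the shift by one.\<close>
  define s where "s = nat (k mod int \<rho>) + 1"
  have \<rho>: "\<rho> > 0"
    using \<rho>_cases by auto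
  then have "k mod int \<rho> < int \<rho>" "0 \<le> k mod int \<rho>"
    by simp_all
  then have s: "s \<in> {1..\<rho>}" "rat_of_nat s - 1 = of_int (k mod int \<rho>)"
    by (auto simp: s_def)
  have "rat_of_int k = of_int (k mod int \<rho>) + of_nat \<rho> * of_int (k div int \<rho>)"
    by (metis mod_mult_div_eq of_int_add of_int_mult of_int_of_nat_eq)
  then have "n = base s + h * of_int (k div int \<rho>)"
    unfolding k s(2) h_eq by (simp add: algebra_simps)
  then show ?thesis
    using that s(1) \<delta>_shift by metis
qed

end

context lie_node_flip
begin

lemma subst_Y: "f \<in> Y \<Longrightarrow> flip.subst f \<in> Y"
proof -
  have "subfield {f. flip.subst f \<in> Y} ratfun_ring"
    by (rule type_subfieldI)
      (simp_all add: flip.subst_add flip.subst_mult flip.subst_uminus flip.subst_inverse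
        Y.add Y.mult Y.uminus Y.inverse)
  moreover have "flip.subst (yv g m j n) \<in> Y" if "j \<in> index_set g" "n \<in> residues g m" for j n
    using that by (cases "j = i") (simp_all add: subst_yv subst_yv_other r_Y yv_Y residues_lattice)
  ultimately have "Y \<subseteq> {f. flip.subst f \<in> Y}"
    by (subst Y_field_def, intro adjoin_least) (auto simp: const_Y)
  then show "f \<in> Y \<Longrightarrow> flip.subst f \<in> Y"
    by blast
qed

lemma restrict_subst_automorphism: "restrict flip.subst Y \<in> Y_automorphisms g m"
proof -
  have "bij_betw flip.subst Y Y"
    by (rule bij_betwI[where g = flip.subst]) (auto intro: subst_Y)
  then have "bij_betw (restrict flip.subst Y) Y Y"
    by (simp only: bij_betw_restrict_eq)
  moreover have "restrict flip.subst Y \<in> ring_hom (Y_ring g m) (Y_ring g m)"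
    by (rule ring_hom_memI)
      (simp_all add: Y_ring_def subst_Y Y.add Y.mult flip.subst_add flip.subst_mult)
  ultimately show ?thesis
    by (simp add: Y_automorphisms_def ring_iso_def Y_ring_def const_Y)
qed

text \<open>Valid for every \<open>A\<close>, not only for the full reflection; the flips of single
  classes rest on this generality.\<close>

lemma subst_Z: "f \<in> Z \<Longrightarrow> flip.subst f = f"
proof -
  have "Z \<subseteq> {f. flip.subst f = f}"
    unfolding Z_field_def
    by (intro adjoin_least flip.subfield_fixed) (auto simp: subst_zv subst_yv_other)
  then show "f \<in> Z \<Longrightarrow> flip.subst f = f"
    by blast
qed

end

section \<open>The function field as a quadratic extension of the invariants\<close>

context lie_node
begin

interpretation all: lie_node_flip g m i UNIV
  by unfold_locales simp

text \<open>The flip of all classes proves existence, and agreement on generators proves uniqueness,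
  so the definite description denotes this map.\<close>

lemma simple_reflection_eq: "simple_reflection g m i = restrict all.flip.subst Y"
proof -
  let ?s = "restrict all.flip.subst Y"
  let ?spec = "\<lambda>r. r \<in> Y_automorphisms g m \<and>
        (\<forall>n \<in> residues g m.
           r (yv g m i n) =
             Pv g m i (n - 2 * half_norm g i) / Pv g m i (n - half_norm g i)
               * yv g m i n * Xv g m i (n - half_norm g i)) \<and>
        (\<forall>j \<in> index_set g - {i}. \<forall>n \<in> residues g m. r (yv g m j n) = yv g m j n)"
  have "?spec ?s"
    using all.restrict_subst_automorphism
    by (auto simp: yv_Y i residues_lattice all.subst_yv all.subst_yv_other chain.r_def P_eq W_eq)
  moreover have "r = ?s" if "?spec r" for r
  proof (rule Y_automorphisms_eqI)
    show "r (yv g m j n) = ?s (yv g m j n)" if "j \<in> index_set g" "n \<in> residues g m" for j n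
      using \<open>?spec r\<close> \<open>?spec ?s\<close> that by (cases "j = i") auto
  qed (use that all.restrict_subst_automorphism in auto)
  ultimately show ?thesis
    unfolding simple_reflection_def by (rule the_equality)
qed

lemma Y_invariants_eq: "Y_invariants g m i = {f \<in> Y. all.flip.subst f = f}"
  by (auto simp: Y_invariants_def simple_reflection_eq)

text \<open>The square is the discriminant \<open>t * t - 4 * G\<close> of the monodromy, with trace
  \<open>t\<close> and determinant \<open>G\<close> in \<open>Z\<close>. The eigenvalue
  \<open>E = (t + \<delta> n) / 2\<close> is also \<open>c * y + e\<close> for
  \<open>y = yv g m i n\<close>, which is solved for \<open>y\<close>.\<close>

lemma \<delta>_square_Z: "\<delta> n * \<delta> n \<in> Z"
  and yv_quadratic: "\<exists>a\<in>Z. \<exists>b\<in>Z. yv g m i n = a + b * \<delta> n"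
  if n: "n \<in> lattice"
proof -
  define E where "E = chain.cprod (yv g m i) n"
  define G where "G = chain.cprod (Fv g m i) n"
  have E: "E \<noteq> 0"
    by (simp add: E_def)
  obtain c e t where cet: "c \<in> Z" "e \<in> Z" "t \<in> Z" "c * yv g m i n + e = E" "E + G / E = t"
    unfolding E_def G_def
    by (rule chain.monodromy[of Z n])
      (use n in \<open>auto simp: z_eq intro: Z.diff Z.mult zv_Z Fv_Z lattice_h1\<close>)
  have \<delta>: "\<delta> n = E - G / E"
    by (simp add: \<delta>_def E_def G_def)
  have G: "G = E * (t - E)"
    using cet(5) E by (simp add: field_simps)
  have two: "2 \<in> Z" "4 \<in> Z"
    by (rule Z.numeral)+
  have "\<delta> n * \<delta> n = t * t - 4 * G"
    unfolding \<delta> cet(5)[symmetric] using E by (simp add: field_simps)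
  also have "\<dots> \<in> Z"
    using cprod_F_Z[OF n] unfolding G_def by (intro Z.diff Z.mult cet two)
  finally show "\<delta> n * \<delta> n \<in> Z" .
  \<comment> \<open>Otherwise \<open>E\<close> would lie in \<open>Z\<close>, so the reflection
    would fix \<open>\<delta> n\<close>; but it changes its sign, and \<open>\<delta> n\<close> is
    nonzero.\<close>
  have "c \<noteq> 0"
  proof
    assume "c = 0"
    then have "E \<in> Z"
      using cet by simp
    then have "all.flip.subst E = E" "all.flip.subst G = G"
      using cprod_F_Z[OF n] by (simp_all add: all.subst_Z G_def)
    then have "all.flip.subst (\<delta> n) = \<delta> n"
      by (simp add: \<delta> all.flip.subst_diff all.flip.subst_divide)
    then show False
      using \<delta>_nonzero[of n] by (simp add: all.subst_\<delta> ratfun_neg_eq_self)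
  qed
  have "2 * E = t + \<delta> n"
    unfolding \<delta> cet(5)[symmetric] by simp
  have "c * yv g m i n = E - e"
    using cet(4) by (simp add: eq_diff_eq)
  have "yv g m i n * (2 * c) = 2 * (c * yv g m i n)"
    by (simp only: mult_ac)
  also have "\<dots> = 2 * E - 2 * e"
    unfolding \<open>c * yv g m i n = E - e\<close> by (rule right_diff_distrib)
  also have "\<dots> = t - 2 * e + \<delta> n"
    unfolding \<open>2 * E = t + \<delta> n\<close> by simp
  finally have "yv g m i n * (2 * c) = t - 2 * e + \<delta> n" .
  moreover have "2 * c \<noteq> 0"
    using \<open>c \<noteq> 0\<close> ratfun_two_nonzero by simp
  ultimately have "yv g m i n = (t - 2 * e + \<delta> n) / (2 * c)"
    by (rule nonzero_eq_divide_eq[THEN iffD2, rotated])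
  then have "yv g m i n = (t - 2 * e) / (2 * c) + 1 / (2 * c) * \<delta> n"
    by (simp add: add_divide_distrib)
  then show "\<exists>a\<in>Z. \<exists>b\<in>Z. yv g m i n = a + b * \<delta> n"
    by (intro bexI[of _ "(t - 2 * e) / (2 * c)"] bexI[of _ "1 / (2 * c)"] Z.diff Z.divide Z.mult
        Z.one cet two) simp_all
qed

text \<open>\<open>Y\<close> is the quadratic extension \<open>K(\<delta>\<^sub>1)\<close>, and \<open>r\<^sub>i\<close> maps \<open>\<delta>\<^sub>1\<close> to \<open>- \<delta>\<^sub>1\<close> and fixes \<open>K\<close>.\<close>

lemma Y_invariants_eqI:
  assumes K: "type_subfield K" and "Z \<subseteq> K"
    and fixed: "\<And>f. f \<in> K \<Longrightarrow> f \<in> Y \<and> all.flip.subst f = f"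
    and \<delta>: "\<And>s. s \<in> {1..\<rho>} \<Longrightarrow> \<delta> (base s) / \<delta> (base 1) \<in> K"
  shows "Y_invariants g m i = K"
proof
  interpret K: type_subfield K by fact
  let ?D = "\<delta> (base 1)"
  let ?E = "{a + b * ?D | a b. a \<in> K \<and> b \<in> K}"
  have D: "?D * ?D \<in> K"
    using \<delta>_square_Z[OF base_lattice] assms(2) by blast
  interpret E: type_subfield ?E
    by (rule type_subfield.intro) (rule K.subfield_quadratic[OF D])
  have K_E: "K \<subseteq> ?E"
    by (force intro: exI[of _ 0])
  have "?D \<in> ?E"
    by (force intro: exI[of _ 0] exI[of _ 1])
  have "yv g m i n \<in> ?E" if n: "n \<in> lattice" for n
  proof -
    obtain s where s: "s \<in> {1..\<rho>}" "\<delta> n = \<delta> (base s)"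
      using \<delta>_base[OF n] .
    then have "\<delta> n = \<delta> (base s) / ?D * ?D"
      using \<delta>_nonzero by simp
    also have "\<dots> \<in> ?E"
      using K_E \<delta>[OF s(1)] \<open>?D \<in> ?E\<close> by (intro E.mult) blast+
    finally have "\<delta> n \<in> ?E" .
    obtain a b where ab: "a \<in> Z" "b \<in> Z" "yv g m i n = a + b * \<delta> n"
      using yv_quadratic[OF n] by blast
    then have "a \<in> ?E" "b \<in> ?E"
      using assms(2) K_E by blast+
    then show ?thesis
      unfolding ab(3) using \<open>\<delta> n \<in> ?E\<close> by (intro E.add E.mult)
  qed
  then have gens: "yv g m j n \<in> ?E" if "j \<in> index_set g" "n \<in> residues g m" for j n
    using yv_Z[of j n] assms(2) K_E residues_lattice[OF that(2)] that(1) by (cases "j = i") blast+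
  have "Y \<subseteq> ?E"
    unfolding Y_field_def
  proof (rule adjoin_least)
    show "range ratfun_const \<subseteq> ?E"
      using const_Z assms(2) K_E by blast
    show "{yv g m j n |j n. j \<in> index_set g \<and> n \<in> residues g m} \<subseteq> ?E"
      using gens by blast
  qed (rule E.subfield)
  show "Y_invariants g m i \<subseteq> K"
  proof
    fix f assume f: "f \<in> Y_invariants g m i"
    then obtain a b where ab: "f = a + b * ?D" "a \<in> K" "b \<in> K"
      using \<open>Y \<subseteq> ?E\<close> unfolding Y_invariants_eq by blast
    then have "all.flip.subst f = a - b * ?D"
      by (simp add: all.flip.subst_add all.flip.subst_mult all.subst_\<delta> fixed)
    moreover have "all.flip.subst f = f"
      using f by (simp add: Y_invariants_eq)
    \<comment> \<open>Invariance kills the coefficient of \<open>\<delta> (base 1)\<close>, so only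
      the part in \<open>K\<close> survives.\<close>
    ultimately have "- (b * ?D) = b * ?D"
      unfolding ab(1) by simp
    then show "f \<in> K"
      unfolding ratfun_neg_eq_self using ab by (simp add: \<delta>_nonzero)
  qed
  show "K \<subseteq> Y_invariants g m i"
    using fixed by (auto simp: Y_invariants_eq)
qed

lemma fixed_adjoin:
  assumes "\<And>f. f \<in> S \<Longrightarrow> f \<in> Y \<and> all.flip.subst f = f" "f \<in> adjoin Z S"
  shows "f \<in> Y \<and> all.flip.subst f = f"
proof -
  have "adjoin Z S \<subseteq> Y"
    using assms Z_subset_Y by (intro adjoin_least Y.subfield) auto
  moreover have "adjoin Z S \<subseteq> {f. all.flip.subst f = f}"
    using assms by (intro adjoin_least all.flip.subfield_fixed) (auto simp: all.subst_Z)
  ultimately show ?thesis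
    using assms(2) by blast
qed

lemma delta_mult_fixed:
  "\<delta> (base s) * \<delta> (base t) \<in> Y \<and>
    all.flip.subst (\<delta> (base s) * \<delta> (base t)) = \<delta> (base s) * \<delta> (base t)"
  by (auto simp: all.flip.subst_mult all.subst_\<delta> intro: Y.mult \<delta>_Y base_lattice)

text \<open>The unreduced form of \<open>residue_class g m i s\<close>, closed under shifts by
  \<open>h\<close> and so usable as the set \<open>A\<close> of a flip.\<close>

definition progression :: "nat \<Rightarrow> rat set" where
  "progression s = {n. (n - base s) / h \<in> \<int>}"

text \<open>The starting points differ by fewer than \<open>\<rho>\<close> steps of length d,
  whereas members of one progression differ by multiples of \<open>\<rho>\<close> steps.\<close>

lemma base_progression:
  assumes "s \<in> {1..\<rho>}" "t \<in> {1..\<rho>}"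
  shows "base t \<in> progression s \<longleftrightarrow> t = s"
proof
  assume "base t \<in> progression s"
  then obtain k where "(base t - base s) / h = of_int k"
    by (auto simp: progression_def elim: Ints_cases)
  moreover have "(base t - base s) / h = of_int (int t - int s) / of_nat \<rho>"
    using d_pos by (simp add: h_eq flip: left_diff_distrib)
  moreover have "\<rho> > 0"
    using \<rho>_cases by auto
  ultimately have "rat_of_int (int t - int s) = of_int (int \<rho> * k)"
    by (simp add: field_simps)
  then have "int t - int s = int \<rho> * k"
    by (rule of_int_eq_iff[THEN iffD1])
  moreover have "\<bar>int t - int s\<bar> < int \<rho>"
    using assms by auto
  ultimately show "t = s"
    by (metis abs_of_nat dvd_imp_le_int dvd_triv_left eq_iff_diff_eq_0 linorder_not_le of_nat_eq_iff)
qed (simp add: progression_def)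

lemma lie_node_flip_progression: "lie_node_flip g m i (progression s)"
proof (intro lie_node_flip.intro lie_node_flip_axioms.intro lie_node_axioms)
  fix n
  have "(n - h - base s) / h = (n - base s) / h - 1"
    using h_pos by (simp add: field_simps)
  then show "n - h \<in> progression s \<longleftrightarrow> n \<in> progression s"
    unfolding progression_def using Ints_add[of "(n - base s) / h - 1" 1] Ints_diff[of _ 1] by auto
qed

text \<open>The flip of class \<open>t\<close> alone fixes \<open>Z\<close> and every product in
  \<open>S\<close>, since none involves class \<open>t\<close>, but it negates the product in
  question.\<close>

lemma delta_mult_notin:
  assumes "s \<in> {1..\<rho>}" "t \<in> {1..\<rho>}" "s \<noteq> t"
    and S: "S \<subseteq> {\<delta> (base u) * \<delta> (base v) | u v. u \<in> {1..\<rho>} - {t} \<and> v \<in> {1..\<rho>} - {t}}"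
  shows "\<delta> (base s) * \<delta> (base t) \<notin> adjoin Z S"
proof
  interpret t: lie_node_flip g m i "progression t"
    by (rule lie_node_flip_progression)
  assume "\<delta> (base s) * \<delta> (base t) \<in> adjoin Z S"
  moreover have "adjoin Z S \<subseteq> {f. t.flip.subst f = f}"
    using S assms(2)
    by (intro adjoin_least t.flip.subfield_fixed)
      (fastforce simp: t.subst_Z t.flip.subst_mult t.subst_\<delta> base_progression)+
  ultimately have "t.flip.subst (\<delta> (base s) * \<delta> (base t)) = \<delta> (base s) * \<delta> (base t)"
    by blast
  then have "- (\<delta> (base s) * \<delta> (base t)) = \<delta> (base s) * \<delta> (base t)"
    using assms by (simp add: t.flip.subst_mult t.subst_\<delta> base_progression)
  then show False
    using \<delta>_nonzero by (simp add: ratfun_neg_eq_self)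
qed

lemma delta_mult_square:
  "(\<delta> (base s) * \<delta> (base t)) * (\<delta> (base s) * \<delta> (base t)) \<in> Z"
  using Z.mult[OF \<delta>_square_Z \<delta>_square_Z, OF base_lattice base_lattice, of s t]
  by (simp add: mult_ac)

section \<open>Invariants and degrees for each ratio d_i/d\<close>

lemma shortest_root:
  assumes "\<rho> = 1"
  shows "Y_invariants g m i = Z"
proof (rule Y_invariants_eqI)
  show "f \<in> Y \<and> all.flip.subst f = f" if "f \<in> Z" for f
    using that Z_subset_Y all.subst_Z by blast
  show "\<delta> (base s) / \<delta> (base 1) \<in> Z" if "s \<in> {1..\<rho>}" for s
    using that assms \<delta>_nonzero by simp
qed (simp_all add: Z.type_subfield_axioms)

lemma double_root:
  assumes "\<rho> = 2"
  defines "K \<equiv> adjoin Z {\<delta> (base 1) * \<delta> (base 2)}"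
  shows "Y_invariants g m i = K" "ring.dimension ratfun_ring 2 Z K"
proof -
  interpret K: type_subfield K
    unfolding K_def by (rule type_subfield_adjoin)
  have ZK: "Z \<subseteq> K"
    unfolding K_def by (auto intro: adjoin_base)
  have "\<delta> (base 1) * \<delta> (base 2) \<in> K"
    unfolding K_def by (rule adjoin_gen) simp
  moreover have "\<delta> (base 1) * \<delta> (base 1) \<in> K"
    using ZK \<delta>_square_Z[OF base_lattice] by blast
  \<comment> \<open>Since squares of the \<delta> lie in \<open>Z\<close>, a product of two of them
    is as good as their quotient.\<close>
  ultimately have "\<delta> (base 1) * \<delta> (base 2) / (\<delta> (base 1) * \<delta> (base 1)) \<in> K"
    by (rule K.divide)
  then have 2: "\<delta> (base 2) / \<delta> (base 1) \<in> K"
    using \<delta>_nonzero by simp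
  show "Y_invariants g m i = K"
  proof (rule Y_invariants_eqI[OF K.type_subfield_axioms ZK])
    show "f \<in> Y \<and> all.flip.subst f = f" if "f \<in> K" for f
    proof (rule fixed_adjoin[OF _ that[unfolded K_def]])
      fix f assume "f \<in> {\<delta> (base 1) * \<delta> (base 2)}"
      then show "f \<in> Y \<and> all.flip.subst f = f"
        by (elim insertE emptyE) (simp_all only: delta_mult_fixed)
    qed
    show "\<delta> (base s) / \<delta> (base 1) \<in> K" if "s \<in> {1..\<rho>}" for s
    proof -
      have "s = 1 \<or> s = 2"
        using that assms by auto
      then show ?thesis
        using 2 \<delta>_nonzero by auto
    qed
  qed
  \<comment> \<open>The empty adjunction only brings \<open>Z\<close> into the form of the
    independence lemma.\<close>
  have "\<delta> (base 1) * \<delta> (base 2) \<notin> adjoin Z {}"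
    by (rule delta_mult_notin) (auto simp: assms)
  then have "\<delta> (base 1) * \<delta> (base 2) \<notin> Z"
    by (auto intro: adjoin_base)
  then show "ring.dimension ratfun_ring 2 Z K"
    unfolding K_def by (intro dimension_adjoin_quadratic Z.subfield delta_mult_square)
qed

lemma triple_root:
  assumes "\<rho> = 3"
  defines "K \<equiv> adjoin Z {\<delta> (base 1) * \<delta> (base 2), \<delta> (base 2) * \<delta> (base 3)}"
  shows "Y_invariants g m i = K" "ring.dimension ratfun_ring 4 Z K"
proof -
  interpret K: type_subfield K
    unfolding K_def by (rule type_subfield_adjoin)
  have ZK: "Z \<subseteq> K"
    unfolding K_def by (auto intro: adjoin_base)
  have gens: "\<delta> (base 1) * \<delta> (base 2) \<in> K" "\<delta> (base 2) * \<delta> (base 3) \<in> K"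
    unfolding K_def by (rule adjoin_gen; simp)+
  have sq: "\<delta> (base s) * \<delta> (base s) \<in> K" for s
    using ZK \<delta>_square_Z[OF base_lattice] by blast
  have "\<delta> (base 1) * \<delta> (base 2) / (\<delta> (base 1) * \<delta> (base 1)) \<in> K"
    by (intro K.divide gens sq)
  then have 2: "\<delta> (base 2) / \<delta> (base 1) \<in> K"
    using \<delta>_nonzero by simp
  \<comment> \<open>The third ratio is reached through the second class, as the generators link only
    neighbouring indices.\<close>
  have "\<delta> (base 2) / \<delta> (base 1) * (\<delta> (base 2) * \<delta> (base 3) / (\<delta> (base 2) * \<delta> (base 2))) \<in> K"
    by (intro K.mult K.divide gens sq 2)
  then have 3: "\<delta> (base 3) / \<delta> (base 1) \<in> K"
    using \<delta>_nonzero by simp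
  show "Y_invariants g m i = K"
  proof (rule Y_invariants_eqI[OF K.type_subfield_axioms ZK])
    show "f \<in> Y \<and> all.flip.subst f = f" if "f \<in> K" for f
    proof (rule fixed_adjoin[OF _ that[unfolded K_def]])
      fix f assume "f \<in> {\<delta> (base 1) * \<delta> (base 2), \<delta> (base 2) * \<delta> (base 3)}"
      then show "f \<in> Y \<and> all.flip.subst f = f"
        by (elim insertE emptyE) (simp_all only: delta_mult_fixed)
    qed
    show "\<delta> (base s) / \<delta> (base 1) \<in> K" if "s \<in> {1..\<rho>}" for s
    proof -
      have "s = 1 \<or> s = 2 \<or> s = 3"
        using that assms by auto
      then show ?thesis
        using 2 3 \<delta>_nonzero by auto
    qed
  qed
  \<comment> \<open>The degree 4 comes from a tower of two quadratic steps. Flipping class 3 fixes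
    this intermediate field and negates the second generator, so the second step is proper.\<close>
  let ?K' = "adjoin Z {\<delta> (base 1) * \<delta> (base 2)}"
  interpret K': type_subfield ?K'
    by (rule type_subfield_adjoin)
  have "\<delta> (base 1) * \<delta> (base 2) \<notin> adjoin Z {}"
    by (rule delta_mult_notin) (auto simp: assms)
  then have "\<delta> (base 1) * \<delta> (base 2) \<notin> Z"
    by (auto intro: adjoin_base)
  then have dim1: "ring.dimension ratfun_ring 2 Z ?K'"
    by (intro dimension_adjoin_quadratic Z.subfield delta_mult_square)
  have "{\<delta> (base 1) * \<delta> (base 2)} \<subseteq>
      {\<delta> (base u) * \<delta> (base v) | u v. u \<in> {1..\<rho>} - {3} \<and> v \<in> {1..\<rho>} - {3}}"
    unfolding insert_subset
    by (rule conjI, rule CollectI, rule exI[of _ 1], rule exI[of _ 2]) (simp_all add: assms(1))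
  then have "\<delta> (base 2) * \<delta> (base 3) \<notin> ?K'"
    by (rule delta_mult_notin[rotated 3]) (simp_all add: assms(1))
  moreover have "\<delta> (base 2) * \<delta> (base 3) * (\<delta> (base 2) * \<delta> (base 3)) \<in> ?K'"
    by (rule adjoin_base) (rule delta_mult_square)
  ultimately have "ring.dimension ratfun_ring 2 ?K' (adjoin ?K' {\<delta> (base 2) * \<delta> (base 3)})"
    by (intro dimension_adjoin_quadratic K'.subfield)
  then have "ring.dimension ratfun_ring 2 ?K' K"
    by (simp add: adjoin_adjoin K_def insert_commute)
  then have "ring.dimension ratfun_ring (2 * 2) Z K"
    by (rule Y.amb.telescopic_base[OF Z.subfield K'.subfield dim1])
  then show "ring.dimension ratfun_ring 4 Z K"
    by simp
qed

end

theorem theorem1p1: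
  fixes g :: lie_type and m i :: nat
  assumes "simple_lie_type g" and "m > 1" and "i \<in> index_set g"
  shows "(half_norm g i = min_half_norm g \<longrightarrow> Y_invariants g m i = Z_field g m i) \<and>
    (half_norm g i \<noteq> min_half_norm g \<longrightarrow>
       Y_invariants g m i = Z_field' g m i \<and>
       (half_norm g i = 2 * min_half_norm g \<longrightarrow>
          ring.dimension ratfun_ring 2 (Z_field g m i) (Z_field' g m i)) \<and>
       (half_norm g i = 3 * min_half_norm g \<longrightarrow>
          ring.dimension ratfun_ring 4 (Z_field g m i) (Z_field' g m i)))"
proof -
  interpret lie_node g m i
    by standard (rule assms)+
  \<comment> \<open>Turns the conditions on root lengths into the value of \<open>\<rho>\<close>,
    which selects the branch of \<open>Z_field'\<close>.\<close>
  have \<rho>_iff: "half_norm g i = of_nat k * min_half_norm g \<longleftrightarrow> \<rho> = k" for k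
    using d_pos by (simp add: h_eq)
  note \<rho> = \<rho>_iff[of 1, simplified] \<rho>_iff[of 2, simplified] \<rho>_iff[of 3, simplified]
  consider "\<rho> = 1" | "\<rho> = 2" | "\<rho> = 3"
    using \<rho>_cases by blast
  then show ?thesis
  proof cases
    case 1
    then show ?thesis
      using shortest_root by (simp add: \<rho>)
  next
    case 2
    then show ?thesis
      using double_root by (simp add: \<rho> Z_field'_def delta_eq)
  next
    case 3
    then show ?thesis
      using triple_root by (simp add: \<rho> Z_field'_def delta_eq)
  qed
qed

end
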